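(* Let $Q$ be a basic sequence that is infinite in limit. Then (1) a real number is AP $Q$-distribution normal of type I if and only if it is AP $Q$-distribution normal of type II; and (2) the set of real numbers that are $Q$-distribution normal and AP $Q$-distribution abnormal is a meagre set of Lebesgue measure zero with Hausdorff dimension $1$.
   Context: A basic sequence is $Q=(q_n)_{n\ge1}$ with integers $q_n\ge2$; infinite in limit means $q_n\to\infty$. The $Q$-Cantor series expansion of $x$ is $x=E_0+\sum_{n\ge1}\frac{E_n}{q_1\cdots q_n}$ with $E_0=\lfloor x\rfloor$, $E_n\in\{0,\dots,q_n-1\}$, $E_n\ne q_n-1$ infinitely often; written $x=E_0.E_1E_2\cdots$ w.r.t. $Q$. $T_{Q,n}(x)=q_n\cdots q_1x\bmod1$. A sequence $(x_n)$ in $[0,1)$ is u.d. mod 1 if $\#\{i\le n:x_i\in[0,t)\}/n\to t$ for all $t\in[0,1]$. $x$ is $Q$-distribution normal if $(T_{Q,n}(x))_{n\ge0}$ is u.d. mod 1. $x$ is AP $Q$-distribution normal of type I if for all $m\in\mathbb{N}$ and $0\le r<m$ the sequence $(T_{Q,mn+r}(x))_{n\ge0}$ is u.d. mod 1. $x$ is AP $Q$-distribution normal of type II if for all $m\in\mathbb{N}$ and $0\le r<m$ the real number $0.E_rE_{m+r}E_{2m+r}\cdots$ is $\{q_{m(n-1)+r}\}_{n=1}^\infty$-distribution normal. $x$ is AP $Q$-distribution abnormal if $(T_{Q,mn+r}(x))_{n\ge0}$ is not u.d. mod 1 for every $m>1$ and $0\le r<m$.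
   Formalization: In type II with r = 0 the given definition refers to q_0 and to E_0 = ⌊x⌋ as a digit, which are undefined there; the class r = 0 is read as 0.E_m E_{2m} E_{3m}… with respect to (q_m, q_{2m}, q_{3m}, …). *)

theory Defs
  imports "HOL-Analysis.Analysis"
begin

section \<open>Cantor series expansions\<close>

text \<open>A basic sequence is indexed by the integers \<open>n \<ge> 1\<close>; the value \<open>q 0\<close> is never used.\<close>

definition basic_sequence :: "(nat \<Rightarrow> nat) \<Rightarrow> bool" where
  "basic_sequence q \<longleftrightarrow> (\<forall>n\<ge>1. q n \<ge> 2)"

definition infinite_in_limit :: "(nat \<Rightarrow> nat) \<Rightarrow> bool" where
  "infinite_in_limit q \<longleftrightarrow> filterlim q at_top sequentially"

definition is_cantor_expansion :: "(nat \<Rightarrow> nat) \<Rightarrow> real \<Rightarrow> (nat \<Rightarrow> int) \<Rightarrow> bool" where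
  "is_cantor_expansion q x E \<longleftrightarrow>
     E 0 = \<lfloor>x\<rfloor> \<and>
     (\<forall>n\<ge>1. E n \<in> {0..int (q n) - 1}) \<and>
     (\<exists>\<^sub>\<infinity>n. E n \<noteq> int (q n) - 1) \<and>
     (\<lambda>n. real_of_int (E (Suc n)) / real (\<Prod>k=1..Suc n. q k)) sums (x - real_of_int (E 0))"

text \<open>For a basic sequence every real number has exactly one such expansion.\<close>

definition cantor_digits :: "(nat \<Rightarrow> nat) \<Rightarrow> real \<Rightarrow> nat \<Rightarrow> int" where
  "cantor_digits q x = (THE E. is_cantor_expansion q x E)"

text \<open>The real number \<open>0.E\<^sub>1E\<^sub>2E\<^sub>3\<dots>\<close> with respect to \<open>q\<close>. The digits need not form an admissible
  expansion (they may eventually all be maximal); only the value of the series matters.\<close>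

definition cantor_value :: "(nat \<Rightarrow> nat) \<Rightarrow> (nat \<Rightarrow> int) \<Rightarrow> real" where
  "cantor_value q E = (\<Sum>n. real_of_int (E (Suc n)) / real (\<Prod>k=1..Suc n. q k))"

definition cantor_T :: "(nat \<Rightarrow> nat) \<Rightarrow> nat \<Rightarrow> real \<Rightarrow> real" where
  "cantor_T q n x = frac (real (\<Prod>k=1..n. q k) * x)"


section \<open>Distribution normality\<close>

definition ud_mod1 :: "(nat \<Rightarrow> real) \<Rightarrow> bool" where
  "ud_mod1 s \<longleftrightarrow>
     (\<forall>t\<in>{0..1}. (\<lambda>n. real (card {i. i < n \<and> s i \<in> {0..<t}}) / real n) \<longlonglongrightarrow> t)"

definition distribution_normal :: "(nat \<Rightarrow> nat) \<Rightarrow> real \<Rightarrow> bool" where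
  "distribution_normal q x \<longleftrightarrow> ud_mod1 (\<lambda>n. cantor_T q n x)"

definition AP_distribution_normal_I :: "(nat \<Rightarrow> nat) \<Rightarrow> real \<Rightarrow> bool" where
  "AP_distribution_normal_I q x \<longleftrightarrow>
     (\<forall>m\<ge>1. \<forall>r<m. ud_mod1 (\<lambda>n. cantor_T q (m * n + r) x))"

text \<open>The position of the \<open>n\<close>-th term (\<open>n \<ge> 1\<close>) of the residue class \<open>r\<close> modulo \<open>m\<close> among the
  positive integers. For \<open>r = 0\<close> the position \<open>0\<close> is skipped: there is no \<open>q\<^sub>0\<close>, and \<open>E\<^sub>0\<close> is the
  integer part, not a digit.\<close>

definition AP_index :: "nat \<Rightarrow> nat \<Rightarrow> nat \<Rightarrow> nat" where
  "AP_index m r n = (if r = 0 then m * n else m * (n - 1) + r)"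

definition AP_distribution_normal_II :: "(nat \<Rightarrow> nat) \<Rightarrow> real \<Rightarrow> bool" where
  "AP_distribution_normal_II q x \<longleftrightarrow>
     (\<forall>m\<ge>1. \<forall>r<m.
        distribution_normal (\<lambda>n. q (AP_index m r n))
          (cantor_value (\<lambda>n. q (AP_index m r n)) (\<lambda>n. cantor_digits q x (AP_index m r n))))"

definition AP_distribution_abnormal :: "(nat \<Rightarrow> nat) \<Rightarrow> real \<Rightarrow> bool" where
  "AP_distribution_abnormal q x \<longleftrightarrow>
     (\<forall>m>1. \<forall>r<m. \<not> ud_mod1 (\<lambda>n. cantor_T q (m * n + r) x))"


section \<open>Meagre sets and Hausdorff dimension\<close>

definition nowhere_dense :: "'a::topological_space set \<Rightarrow> bool" where
  "nowhere_dense A \<longleftrightarrow> interior (closure A) = {}"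

definition meagre :: "'a::topological_space set \<Rightarrow> bool" where
  "meagre S \<longleftrightarrow> (\<exists>A :: nat \<Rightarrow> 'a set. (\<forall>i. nowhere_dense (A i)) \<and> S = (\<Union>i. A i))"

text \<open>The \<open>s\<close>-th power of the diameter, with the conventions that the empty set has weight \<open>0\<close> and
  that \<open>0\<^sup>0 = 1\<close> for nonempty sets (\<open>powr\<close> would give \<open>0\<close>).\<close>

definition diameter_weight :: "real \<Rightarrow> 'a::metric_space set \<Rightarrow> ennreal" where
  "diameter_weight s U =
     (if U = {} then 0 else if s = 0 then 1 else ennreal (diameter U powr s))"

text \<open>Boundedness is required since \<open>diameter\<close> is unspecified on unbounded sets.\<close>

definition hausdorff_premeasure :: "real \<Rightarrow> real \<Rightarrow> 'a::metric_space set \<Rightarrow> ennreal" where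
  "hausdorff_premeasure s \<delta> S =
     (INF U \<in> {U :: nat \<Rightarrow> 'a set. S \<subseteq> (\<Union>i. U i) \<and> (\<forall>i. bounded (U i) \<and> diameter (U i) \<le> \<delta>)}.
        (\<Sum>i. diameter_weight s (U i)))"

definition hausdorff_measure :: "real \<Rightarrow> 'a::metric_space set \<Rightarrow> ennreal" where
  "hausdorff_measure s S = (SUP \<delta>\<in>{0<..}. hausdorff_premeasure s \<delta> S)"

definition hausdorff_dim :: "'a::metric_space set \<Rightarrow> ennreal" where
  "hausdorff_dim S = (INF s \<in> {s. s \<ge> 0 \<and> hausdorff_measure s S = 0}. ennreal s)"

end

theory Submission
  imports Defs
begin

text \<open>Since \<open>q\<^sub>n \<rightarrow> \<infinity>\<close>, the orbit point \<open>T\<^bsub>Q,n\<^esub>(x)\<close> differs from \<open>E\<^bsub>n+1\<^esub> / q\<^bsub>n+1\<^esub>\<close> by \<open>o(1)\<close>, and uniform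
  distribution is insensitive to such perturbations. Both kinds of AP normality therefore say that the
  ratios \<open>E\<^sub>n / q\<^sub>n\<close> are uniformly distributed along every arithmetic progression.

  Points of \<open>(a / P\<^sub>k, a / P\<^sub>k + 1 / P\<^sub>M)\<close>, with \<open>P\<^sub>n = q\<^sub>1 \<cdots> q\<^sub>n\<close>, spend the times \<open>k, \<dots>, M - 1\<close> in \<open>[0, 1/2)\<close>,
  which makes distribution normality a meagre property. The events \<open>T\<^bsub>Q,2n\<^esub>(x) < t\<close> have exponentially decaying
  correlations, so a second moment argument shows that \<open>(T\<^bsub>Q,2n\<^esub>(x))\<close> is uniformly distributed for almost every
  \<open>x\<close>; hence AP abnormal numbers form a null set.

  For the Hausdorff dimension, fix a uniformly distributed sequence \<open>y\<close> none of whose proper arithmetic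
  subprogressions is uniformly distributed. Numbers whose digits are confined to windows of relative
  length \<open>o(1)\<close> around \<open>y\<^sub>n q\<^sub>n\<close> have orbits asymptotic to \<open>y\<close>. For each \<open>s < 1\<close> the windows can be taken so
  large that the resulting Cantor set maps onto \<open>[0, 1)\<close> by an \<open>s\<close>-Hoelder map, so its \<open>s\<close>-dimensional
  Hausdorff measure is positive.\<close>

section \<open>Cantor expansions and AP normality\<close>

text \<open>AP abnormality is already violated by uniform distribution for m = 2, r = 0, hence the
  even times. The almost sure statement is proved for all positive integer multipliers with 2 R_j
  \<le> R_{j+1}: R_j = P_{2j} yields the null set, R_j = 2^j a uniformly distributed sequence z from
  which y is built.

  The sequence y must spoil countably many progressions and stay uniformly distributed. Bits decide
  which half of [0, 1) receives the next term, and they are organised in blocks [j!, (j+1)!). Such a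
  block outweighs everything before it, so it can pull the frequency along one progression far from
  1/2; both its ends are divisible by the period of the bits, so the bias of one residue class
  cancels exactly against another class.

  In the dimension estimate q_{n+1} may be enormous compared with P_n. A loss of a small power of
  q_{n+1} at level n + 1 could then not be absorbed by a power of P_n, and intermediate scales
  between 1/P_n and 1/P_{n+1} would be lost. This forces the window lengths to depend on the
  preceding term of q.\<close>

lemma ud_mod1_close:
  fixes s t :: "nat \<Rightarrow> real"
  assumes ud: "ud_mod1 s" and s0: "\<And>i. s i \<ge> 0" and t0: "\<And>i. t i \<ge> 0"
    and lim: "(\<lambda>i. s i - t i) \<longlonglongrightarrow> 0"
  shows "ud_mod1 t"
  unfolding ud_mod1_def
proof
  fix u :: real assume u: "u \<in> {0..1}"
  define cs where "cs = (\<lambda>v n. card {i. i < n \<and> s i \<in> {0..<v}})"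
  define ct where "ct = (\<lambda>n. card {i. i < n \<and> t i \<in> {0..<u}})"
  have "(\<lambda>n. real (ct n) / real n) \<longlonglongrightarrow> u"
  proof (rule LIMSEQ_I)
    fix \<epsilon> :: real assume "\<epsilon> > 0"
    define e where "e = \<epsilon> / 4"
    have e: "e > 0" "\<epsilon> = 4 * e" using \<open>\<epsilon> > 0\<close> by (auto simp: e_def)
    obtain N where N: "\<And>i. i \<ge> N \<Longrightarrow> \<bar>s i - t i\<bar> < e"
      using LIMSEQ_D[OF lim e(1)] by auto
    have small: "\<forall>\<^sub>F n in sequentially. real N / real n < e"
      using lim_const_over_n[of "real N"] e(1) by (rule order_tendstoD)
    have cs: "(\<lambda>n. real (cs v n) / real n) \<longlonglongrightarrow> v" if "v \<in> {0..1}" for v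
      using ud that unfolding ud_mod1_def cs_def by blast
    have pos: "\<forall>\<^sub>F n in sequentially. n > (0::nat)" by (rule eventually_gt_at_top)
    \<comment> \<open>Uniform distribution of s is silent about thresholds above 1; there the
      trivial bound 1 < u + e on the frequency replaces it. The lower bound treats u - e < 0 in the
      same way.\<close>
    have up: "\<forall>\<^sub>F n in sequentially. real (ct n) / real n < u + \<epsilon>"
    proof (cases "u + e \<le> 1")
      case True
      have "ct n \<le> N + cs (u + e) n" for n
      proof -
        have "{i. i < n \<and> t i \<in> {0..<u}} \<subseteq> {..<N} \<union> {i. i < n \<and> s i \<in> {0..<u+e}}"
          using N s0 by (force simp: abs_less_iff not_less)
        then have "ct n \<le> card ({..<N} \<union> {i. i < n \<and> s i \<in> {0..<u+e}})"
          unfolding ct_def by (intro card_mono) auto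
        also have "\<dots> \<le> N + cs (u + e) n"
          using card_Un_le[of "{..<N}"] by (simp add: cs_def)
        finally show ?thesis .
      qed
      then have le: "real (ct n) / real n \<le> real N / real n + real (cs (u+e) n) / real n" for n
        by (metis add_divide_distrib divide_right_mono of_nat_0_le_iff of_nat_add of_nat_le_iff)
      have "\<forall>\<^sub>F n in sequentially. real (cs (u+e) n) / real n < u + e + e"
        using cs[of "u+e"] True u e by (intro order_tendstoD) auto
      with small show ?thesis
        by eventually_elim (use le e in \<open>smt (verit)\<close>)
    next
      case False
      have "ct n \<le> n" for n
        unfolding ct_def using card_mono[of "{..<n}" "{i. i < n \<and> t i \<in> {0..<u}}"] by auto
      then have "real (ct n) / real n \<le> 1" for n
        by (cases "n = 0") (simp_all add: divide_le_eq_1)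
      then show ?thesis using False e by (intro always_eventually) (smt (verit))
    qed
    have lo: "\<forall>\<^sub>F n in sequentially. real (ct n) / real n > u - \<epsilon>"
    proof (cases "u - e \<ge> 0")
      case True
      have "cs (u - e) n \<le> N + ct n" for n
      proof -
        have "{i. i < n \<and> s i \<in> {0..<u-e}} \<subseteq> {..<N} \<union> {i. i < n \<and> t i \<in> {0..<u}}"
          using N t0 by (force simp: abs_less_iff not_less)
        then have "cs (u - e) n \<le> card ({..<N} \<union> {i. i < n \<and> t i \<in> {0..<u}})"
          unfolding cs_def by (intro card_mono) auto
        also have "\<dots> \<le> N + ct n"
          using card_Un_le[of "{..<N}"] by (simp add: ct_def)
        finally show ?thesis .
      qed
      then have le: "real (cs (u-e) n) / real n \<le> real N / real n + real (ct n) / real n" for n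
        by (metis add_divide_distrib divide_right_mono of_nat_0_le_iff of_nat_add of_nat_le_iff)
      have "\<forall>\<^sub>F n in sequentially. real (cs (u-e) n) / real n > u - e - e"
        using cs[of "u-e"] True u e by (intro order_tendstoD) auto
      with small show ?thesis
        by eventually_elim (use le e in \<open>smt (verit)\<close>)
    next
      case False
      have "0 \<le> real (ct n) / real n" for n by simp
      then show ?thesis using False e by (intro always_eventually) (smt (verit))
    qed
    from up lo have "\<forall>\<^sub>F n in sequentially. norm (real (ct n) / real n - u) < \<epsilon>"
      by eventually_elim (auto simp: abs_less_iff)
    then show "\<exists>no. \<forall>n\<ge>no. norm (real (ct n) / real n - u) < \<epsilon>"
      by (simp add: eventually_sequentially)
  qed
  then show "(\<lambda>n. real (card {i. i < n \<and> t i \<in> {0..<u}}) / real n) \<longlonglongrightarrow> u"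
    by (simp add: ct_def)
qed

lemma ud_mod1_cong_tendsto:
  fixes s t :: "nat \<Rightarrow> real"
  assumes "\<And>i. s i \<ge> 0" and "\<And>i. t i \<ge> 0" and "(\<lambda>i. s i - t i) \<longlonglongrightarrow> 0"
  shows "ud_mod1 s \<longleftrightarrow> ud_mod1 t"
proof -
  have "(\<lambda>i. t i - s i) \<longlonglongrightarrow> 0" using tendsto_minus[OF assms(3)] by simp
  then show ?thesis using assms ud_mod1_close by metis
qed

lemma not_ud_mod1_const:
  fixes c :: real shows "\<not> ud_mod1 (\<lambda>_. c)"
proof
  assume ud: "ud_mod1 (\<lambda>_. c)"
  then have lim: "(\<lambda>n. real (card {i. i < n \<and> c \<in> {0..<1/2}}) / real n) \<longlonglongrightarrow> 1/2"
    unfolding ud_mod1_def by (elim ballE[of _ _ "1/2"]) auto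
  show False
  proof (cases "c \<in> {0..<1/2}")
    case True
    have "(\<lambda>n. real (card {i. i < n \<and> c \<in> {0..<1/2}}) / real n) \<longlonglongrightarrow> 1"
      using True by (intro tendsto_eventually eventually_mono[OF eventually_gt_at_top[of 0]]) auto
    from LIMSEQ_unique[OF lim this] show False by simp
  next
    case False
    then have "(\<lambda>n. real (card {i. i < n \<and> c \<in> {0..<1/2}}) / real n) \<longlonglongrightarrow> 0"
      by auto
    from LIMSEQ_unique[OF lim this] show False by simp
  qed
qed

lemma not_ud_mod1_convergent:
  fixes s :: "nat \<Rightarrow> real"
  assumes "\<And>i. s i \<ge> 0" and "s \<longlonglongrightarrow> c"
  shows "\<not> ud_mod1 s"
proof -
  have "c \<ge> 0" using assms LIMSEQ_le_const by blast
  moreover have "(\<lambda>i. s i - c) \<longlonglongrightarrow> 0" using assms(2) by (simp add: LIM_zero)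
  ultimately show ?thesis
    using ud_mod1_cong_tendsto[of s "\<lambda>_. c"] assms(1) not_ud_mod1_const by blast
qed

section \<open>Digit strings and their tails; existence and uniqueness of Cantor expansions\<close>

text \<open>Strings that are eventually maximal are included: the digits of a number along a
  progression can be of this kind.\<close>

definition digit_sequence :: "(nat \<Rightarrow> nat) \<Rightarrow> (nat \<Rightarrow> int) \<Rightarrow> bool" where
  "digit_sequence q E \<longleftrightarrow> (\<forall>n\<ge>1. E n \<in> {0..int (q n) - 1})"

text \<open>The number 0.E(n+1)E(n+2)... with respect to the shifted basic sequence. It is congruent
  modulo 1 to the orbit point at time n, but it ranges over [0, 1] with 1 included.\<close>

definition cantor_tail :: "(nat \<Rightarrow> nat) \<Rightarrow> (nat \<Rightarrow> int) \<Rightarrow> nat \<Rightarrow> real" where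
  "cantor_tail q E n = cantor_value (\<lambda>k. q (n + k)) (\<lambda>k. E (n + k))"

lemma basic_sequence_pos: "basic_sequence q \<Longrightarrow> q (Suc n) > 0"
  unfolding basic_sequence_def by (metis One_nat_def le_add1 plus_1_eq_Suc not_gr_zero not_numeral_le_zero)

lemma basic_sequence_shift: "basic_sequence q \<Longrightarrow> basic_sequence (\<lambda>k. q (n + k))"
  by (simp add: basic_sequence_def)

lemma digit_sequence_shift:
  "digit_sequence q E \<Longrightarrow> digit_sequence (\<lambda>k. q (n + k)) (\<lambda>k. E (n + k))"
  by (simp add: digit_sequence_def)

lemma basic_sequence_prod_ge:
  assumes "basic_sequence q" shows "2 ^ n \<le> (\<Prod>k=1..n. q k)"
proof (induction n)
  case (Suc n)
  have "2 * 2 ^ n \<le> q (Suc n) * (\<Prod>k=1..n. q k)"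
    using assms by (intro mult_mono Suc) (auto simp: basic_sequence_def)
  then show ?case by (simp add: mult.commute)
qed simp

lemma basic_sequence_prod_pos:
  assumes "basic_sequence q" shows "(\<Prod>k=1..n. q k) > 0"
  using basic_sequence_prod_ge[OF assms, of n] by (smt (verit) not_gr_zero power_eq_0_iff le_zero_eq zero_neq_numeral)

lemma inverse_prod_tendsto_0:
  assumes "basic_sequence q" shows "(\<lambda>n. 1 / real (\<Prod>k=1..n. q k)) \<longlonglongrightarrow> 0"
proof (rule tendsto_sandwich[of "\<lambda>_. 0" _ _ "\<lambda>n. (1/2)^n"])
  show "\<forall>\<^sub>F n in sequentially. 1 / real (\<Prod>k=1..n. q k) \<le> (1/2)^n"
  proof (intro always_eventually allI)
    fix n
    have "(2::real) ^ n \<le> real (\<Prod>k=1..n. q k)"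
      using basic_sequence_prod_ge[OF assms, of n] by (metis of_nat_le_iff of_nat_numeral of_nat_power)
    then show "1 / real (\<Prod>k=1..n. q k) \<le> (1/2)^n"
      by (simp add: power_one_over frac_le)
  qed
qed (auto intro!: always_eventually LIMSEQ_realpow_zero prod_nonneg)

text \<open>A digit is at most q - 1, so each term is dominated by a difference of consecutive
  reciprocals of products; the partial sums then telescope to at most 1.\<close>

lemma cantor_term_bounds:
  assumes "basic_sequence q" "digit_sequence q E"
  shows "0 \<le> real_of_int (E (Suc n)) / real (\<Prod>k=1..Suc n. q k)"
    and "real_of_int (E (Suc n)) / real (\<Prod>k=1..Suc n. q k)
          \<le> 1 / real (\<Prod>k=1..n. q k) - 1 / real (\<Prod>k=1..Suc n. q k)"
proof -
  have E: "0 \<le> E (Suc n)" "E (Suc n) \<le> int (q (Suc n)) - 1"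
    using assms(2) by (auto simp: digit_sequence_def)
  then show "0 \<le> real_of_int (E (Suc n)) / real (\<Prod>k=1..Suc n. q k)"
    by (intro divide_nonneg_nonneg of_nat_0_le_iff) auto
  let ?P = "real (\<Prod>k=1..n. q k)"
  have P: "?P > 0" using basic_sequence_prod_pos[OF assms(1), of n] by linarith
  have qp: "real (q (Suc n)) > 0" using basic_sequence_pos[OF assms(1), of n] by simp
  have "real_of_int (E (Suc n)) \<le> real (q (Suc n)) - 1" using E by linarith
  then have "real_of_int (E (Suc n)) / (?P * real (q (Suc n))) \<le> (real (q (Suc n)) - 1) / (?P * real (q (Suc n)))"
    using P qp by (intro divide_right_mono) auto
  also have "\<dots> = 1 / ?P - 1 / (?P * real (q (Suc n)))"
    using P qp by (simp add: diff_divide_distrib del: of_nat_prod)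
  finally show "real_of_int (E (Suc n)) / real (\<Prod>k=1..Suc n. q k)
          \<le> 1 / real (\<Prod>k=1..n. q k) - 1 / real (\<Prod>k=1..Suc n. q k)"
    by simp
qed

lemma cantor_partial_sum_le:
  assumes "basic_sequence q" "digit_sequence q E"
  shows "(\<Sum>i<n. real_of_int (E (Suc i)) / real (\<Prod>k=1..Suc i. q k)) \<le> 1"
proof -
  have "(\<Sum>i<n. real_of_int (E (Suc i)) / real (\<Prod>k=1..Suc i. q k))
      \<le> (\<Sum>i<n. 1 / real (\<Prod>k=1..i. q k) - 1 / real (\<Prod>k=1..Suc i. q k))"
    by (intro sum_mono cantor_term_bounds assms)
  also have "\<dots> = 1 - 1 / real (\<Prod>k=1..n. q k)"
    by (subst sum_lessThan_telescope') simp
  also have "\<dots> \<le> 1" by (simp add: prod_nonneg)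
  finally show ?thesis .
qed

lemma summable_cantor_series:
  assumes "basic_sequence q" "digit_sequence q E"
  shows "summable (\<lambda>n. real_of_int (E (Suc n)) / real (\<Prod>k=1..Suc n. q k))"
  by (rule summableI_nonneg_bounded[where x = 1]) (intro cantor_term_bounds cantor_partial_sum_le assms)+

lemma cantor_value_bounds:
  assumes "basic_sequence q" "digit_sequence q E"
  shows "0 \<le> cantor_value q E" and "cantor_value q E \<le> 1"
  unfolding cantor_value_def
  by (intro suminf_nonneg suminf_le_const summable_cantor_series cantor_term_bounds
      cantor_partial_sum_le assms)+

lemma cantor_value_rec:
  assumes q: "basic_sequence q" "digit_sequence q E"
  shows "cantor_value q E =
    (real_of_int (E 1) + cantor_value (\<lambda>k. q (Suc k)) (\<lambda>k. E (Suc k))) / real (q 1)"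
proof -
  have prod: "(\<Prod>k=1..Suc (Suc n). q k) = q 1 * (\<Prod>k=1..Suc n. q (Suc k))" for n
    using prod.atLeast_Suc_atMost[of 1 "Suc (Suc n)" q]
    unfolding prod.shift_bounds_cl_Suc_ivl[of q 1 "Suc n"] by (simp only: One_nat_def le_add1 Suc_le_mono le0)
  have s': "summable (\<lambda>n. real_of_int (E (Suc (Suc n))) / real (\<Prod>k=1..Suc n. q (Suc k)))"
    using summable_cantor_series[OF basic_sequence_shift digit_sequence_shift, OF q, of 1] by simp
  have "cantor_value q E = real_of_int (E 1) / real (q 1)
      + (\<Sum>n. real_of_int (E (Suc (Suc n))) / real (\<Prod>k=1..Suc (Suc n). q k))"
    unfolding cantor_value_def
    using suminf_split_head[OF summable_cantor_series[OF q]] by simp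
  also have "(\<lambda>n. real_of_int (E (Suc (Suc n))) / real (\<Prod>k=1..Suc (Suc n). q k))
     = (\<lambda>n. (real_of_int (E (Suc (Suc n))) / real (\<Prod>k=1..Suc n. q (Suc k))) / real (q 1))"
    by (subst prod) (simp add: mult.commute)
  also have "suminf \<dots> = cantor_value (\<lambda>k. q (Suc k)) (\<lambda>k. E (Suc k)) / real (q 1)"
    unfolding cantor_value_def by (rule suminf_divide[OF s'])
  finally show ?thesis by (simp add: add_divide_distrib)
qed

lemma cantor_tail_0: "cantor_tail q E 0 = cantor_value q E"
  by (simp add: cantor_tail_def)

lemma cantor_tail_bounds:
  assumes "basic_sequence q" "digit_sequence q E"
  shows "0 \<le> cantor_tail q E n" and "cantor_tail q E n \<le> 1"
  unfolding cantor_tail_def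
  by (intro cantor_value_bounds basic_sequence_shift digit_sequence_shift assms)+

lemma cantor_tail_rec:
  assumes "basic_sequence q" "digit_sequence q E"
  shows "real (q (Suc n)) * cantor_tail q E n = real_of_int (E (Suc n)) + cantor_tail q E (Suc n)"
proof -
  have "q (Suc n) > 0" using basic_sequence_pos[OF assms(1), of n] by simp
  then show ?thesis
    unfolding cantor_tail_def
    by (subst cantor_value_rec[OF basic_sequence_shift digit_sequence_shift, OF assms]) simp
qed

text \<open>Each factor q moves one digit in front of the point (\<open>cantor_tail_rec\<close>), so
  the two arguments of \<open>frac\<close> differ by an integer. On the right \<open>frac\<close>
  matters only when the tail is 1.\<close>

lemma frac_prod_cantor_value:
  assumes "basic_sequence q" "digit_sequence q E"
  shows "frac (real (\<Prod>k=1..n. q k) * cantor_value q E) = frac (cantor_tail q E n)"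
proof -
  have "real (\<Prod>k=1..n. q k) * cantor_value q E - cantor_tail q E n \<in> \<int>"
  proof (induction n)
    case 0
    then show ?case by (simp add: cantor_tail_0)
  next
    case (Suc n)
    have "real (\<Prod>k=1..Suc n. q k) * cantor_value q E - cantor_tail q E (Suc n)
      = real (q (Suc n)) * (real (\<Prod>k=1..n. q k) * cantor_value q E - cantor_tail q E n)
        + real_of_int (E (Suc n))"
      using cantor_tail_rec[OF assms, of n] by (simp add: algebra_simps)
    also have "\<dots> \<in> \<int>" using Suc by (intro Ints_add Ints_mult) auto
    finally show ?case .
  qed
  then obtain z where "real (\<Prod>k=1..n. q k) * cantor_value q E = cantor_tail q E n + real_of_int z"
    by (metis Ints_cases diff_eq_eq add.commute)
  then show ?thesis by (simp add: frac_def)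
qed

text \<open>Downward induction from the non-maximal digit: a digit \<le> q - 2 absorbs a following
  tail of at most 1, and at earlier positions a tail below 1 absorbs even a maximal digit.\<close>

lemma cantor_tail_less_1:
  assumes "basic_sequence q" "digit_sequence q E" and "E n \<noteq> int (q n) - 1" "n > m"
  shows "cantor_tail q E m < 1"
proof -
  have digit: "E (Suc i) \<in> {0..int (q (Suc i)) - 1}" for i
    using assms(2) by (auto simp: digit_sequence_def)
  have less: "cantor_tail q E i < 1"
    if "real_of_int (E (Suc i)) + cantor_tail q E (Suc i) < real (q (Suc i))" for i
    using that unfolding cantor_tail_rec[OF assms(1,2), symmetric] by (simp add: mult_less_cancel_left2)
  show ?thesis
    using \<open>n > m\<close>
  proof (induction rule: strict_inc_induct)
    case (base i)
    then have "E (Suc i) \<le> int (q (Suc i)) - 2" using assms(3) digit[of i] by auto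
    then show ?case using cantor_tail_bounds(2)[OF assms(1,2), of "Suc i"] by (intro less) linarith
  next
    case (step i)
    then show ?case using digit[of i] by (intro less) auto
  qed
qed

lemma is_cantor_expansion_tail:
  assumes "basic_sequence q" "is_cantor_expansion q x E"
  shows "digit_sequence q E" and "x = real_of_int (E 0) + cantor_value q E"
    and "cantor_tail q E n < 1"
proof -
  show d: "digit_sequence q E"
    using assms(2) by (simp add: is_cantor_expansion_def digit_sequence_def)
  show "x = real_of_int (E 0) + cantor_value q E"
    using assms(2) by (auto simp: is_cantor_expansion_def cantor_value_def dest!: sums_unique)
  obtain k where "k > n" "E k \<noteq> int (q k) - 1"
    using assms(2) unfolding is_cantor_expansion_def INFM_nat by blast
  then show "cantor_tail q E n < 1" using cantor_tail_less_1[OF assms(1) d] by blast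
qed

text \<open>Tails of expansions lie in [0, 1), so the next digit is the integer part of q times the
  tail: equal tails have equal next digits and equal next tails.\<close>

lemma is_cantor_expansion_unique:
  assumes q: "basic_sequence q" and E: "is_cantor_expansion q x E" and F: "is_cantor_expansion q x F"
  shows "E = F"
proof -
  note e = is_cantor_expansion_tail[OF q E] and f = is_cantor_expansion_tail[OF q F]
  have 0: "E 0 = F 0" using E F by (simp add: is_cantor_expansion_def)
  have step: "E (Suc n) = F (Suc n) \<and> cantor_tail q E (Suc n) = cantor_tail q F (Suc n)"
    if "cantor_tail q E n = cantor_tail q F n" for n
  proof -
    have eq: "real_of_int (E (Suc n)) + cantor_tail q E (Suc n)
        = real_of_int (F (Suc n)) + cantor_tail q F (Suc n)"
      using that cantor_tail_rec[OF q e(1), of n] cantor_tail_rec[OF q f(1), of n] by simp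
    have "E (Suc n) = F (Suc n)"
      using eq e(3)[of "Suc n"] f(3)[of "Suc n"]
        cantor_tail_bounds(1)[OF q e(1), of "Suc n"] cantor_tail_bounds(1)[OF q f(1), of "Suc n"]
      by linarith
    with eq show ?thesis by simp
  qed
  have "cantor_tail q E n = cantor_tail q F n" for n
  proof (induction n)
    case 0
    then show ?case using e(2) f(2) \<open>E 0 = F 0\<close> by (simp add: cantor_tail_0)
  qed (use step in auto)
  then have "E n = F n" for n using 0 step by (cases n) auto
  then show ?thesis by auto
qed

text \<open>The integer is the floor of N * frac x, the first digit of frac x in base N. It serves
  for the Cantor expansion and again for the mixed-radix digits of the parameter of the Cantor
  set.\<close>

lemma floor_digit_bounds:
  fixes x :: real
  assumes "N > (0::nat)"
  shows "0 \<le> \<lfloor>real N * x\<rfloor> - int N * \<lfloor>x\<rfloor>" and "\<lfloor>real N * x\<rfloor> - int N * \<lfloor>x\<rfloor> < int N"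
proof -
  have "real N * x = real_of_int (int N * \<lfloor>x\<rfloor>) + real N * frac x" by (simp add: frac_def algebra_simps)
  then have "\<lfloor>real N * x\<rfloor> = int N * \<lfloor>x\<rfloor> + \<lfloor>real N * frac x\<rfloor>" by (simp only: floor_add_int int_add_floor)
  then have eq: "\<lfloor>real N * x\<rfloor> - int N * \<lfloor>x\<rfloor> = \<lfloor>real N * frac x\<rfloor>" by simp
  have "real N * frac x < real N * 1" using assms frac_lt_1 by (intro mult_strict_left_mono) auto
  then have "\<lfloor>real N * frac x\<rfloor> < int N" by (simp add: floor_less_iff)
  moreover have "0 \<le> real N * frac x" by simp
  ultimately show "0 \<le> \<lfloor>real N * x\<rfloor> - int N * \<lfloor>x\<rfloor>" "\<lfloor>real N * x\<rfloor> - int N * \<lfloor>x\<rfloor> < int N"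
    unfolding eq by simp_all
qed

lemma is_cantor_expansion_exists:
  assumes q: "basic_sequence q"
  shows "\<exists>E. is_cantor_expansion q x E"
proof -
  define P where "P = (\<lambda>n. real (\<Prod>k=1..n. q k))"
  have P0: "P 0 = 1" and PS: "P (Suc n) = real (q (Suc n)) * P n" for n
    by (simp_all add: P_def)
  have Ppos: "P n > 0" for n
    unfolding P_def using basic_sequence_prod_pos[OF q, of n] by linarith
  define E where "E = (\<lambda>n. case n of 0 \<Rightarrow> \<lfloor>x\<rfloor> | Suc m \<Rightarrow> \<lfloor>P (Suc m) * x\<rfloor> - int (q (Suc m)) * \<lfloor>P m * x\<rfloor>)"
  have ES: "E (Suc n) = \<lfloor>P (Suc n) * x\<rfloor> - int (q (Suc n)) * \<lfloor>P n * x\<rfloor>" for n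
    by (simp add: E_def)
  have rec: "real (q (Suc n)) * frac (P n * x) = real_of_int (E (Suc n)) + frac (P (Suc n) * x)" for n
    by (simp add: ES PS frac_def algebra_simps)
  have qpos: "real (q (Suc n)) > 0" for n using basic_sequence_pos[OF q] by simp
  have range: "0 \<le> E (Suc n)" "E (Suc n) < int (q (Suc n))" for n
    using floor_digit_bounds[OF basic_sequence_pos[OF q, of n], of "P n * x"] by (simp_all add: ES PS mult.assoc)
  have dig: "\<forall>n\<ge>1. E n \<in> {0..int (q n) - 1}"
  proof (intro allI impI)
    fix n :: nat assume "1 \<le> n"
    then obtain m where "n = Suc m" by (cases n) auto
    then show "E n \<in> {0..int (q n) - 1}" using range[of m] by auto
  qed
  have inf: "\<exists>\<^sub>\<infinity>n. E n \<noteq> int (q n) - 1"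
  proof (rule ccontr)
    assume "\<not> (\<exists>\<^sub>\<infinity>n. E n \<noteq> int (q n) - 1)"
    then obtain N where N: "\<And>n. n > N \<Longrightarrow> E n = int (q n) - 1"
      unfolding INFM_nat by auto
    \<comment> \<open>If the digits were maximal from some point on, the distance 1 - frac (P n * x)
      would be multiplied by q \<ge> 2 at each further step, although it is positive and at most
      1.\<close>
    define f where "f = (\<lambda>n. 1 - frac (P n * x))"
    have f: "0 < f n" "f n \<le> 1" for n using frac_lt_1 by (auto simp: f_def)
    have grow: "f (Suc n) \<ge> 2 * f n" if "n \<ge> N" for n
    proof -
      have "f (Suc n) = real (q (Suc n)) * f n"
        using rec[of n] N[of "Suc n"] that by (simp add: f_def algebra_simps)
      moreover have "real (q (Suc n)) \<ge> 2" using q by (simp add: basic_sequence_def)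
      ultimately show ?thesis using f(1)[of n] by (simp add: mult_right_mono)
    qed
    have pow: "f (N + k) \<ge> 2 ^ k * f N" for k
    proof (induction k)
      case (Suc k)
      then show ?case using grow[of "N + k"] by simp
    qed simp
    obtain k where "1 / f N < 2 ^ k"
      using real_arch_pow[of 2 "1 / f N"] by auto
    then have "1 < 2 ^ k * f N" using f(1)[of N] by (simp add: divide_less_eq)
    with pow[of k] f(2)[of "N + k"] show False by linarith
  qed
  \<comment> \<open>The terms telescope: up to the integer part, the partial sum is x rounded down
    to a multiple of 1 / P n.\<close>
  have part: "(\<Sum>i<n. real_of_int (E (Suc i)) / P (Suc i)) = real_of_int \<lfloor>P n * x\<rfloor> / P n - real_of_int \<lfloor>x\<rfloor>" for n
  proof (induction n)
    case (Suc n)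
    have "real_of_int (E (Suc n)) / P (Suc n) = real_of_int \<lfloor>P (Suc n) * x\<rfloor> / P (Suc n) - real_of_int \<lfloor>P n * x\<rfloor> / P n"
      using qpos[of n] Ppos[of n] by (simp add: ES PS diff_divide_distrib)
    with Suc show ?case by simp
  qed (simp add: P0)
  have "(\<lambda>n. x - frac (P n * x) / P n) \<longlonglongrightarrow> x - 0"
  proof (intro tendsto_diff tendsto_const)
    show "(\<lambda>n. frac (P n * x) / P n) \<longlonglongrightarrow> 0"
    proof (rule tendsto_sandwich[of "\<lambda>_. 0" _ _ "\<lambda>n. 1 / P n"])
      show "(\<lambda>n. 1 / P n) \<longlonglongrightarrow> 0" unfolding P_def by (rule inverse_prod_tendsto_0[OF q])
      show "\<forall>\<^sub>F n in sequentially. frac (P n * x) / P n \<le> 1 / P n"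
        using Ppos frac_lt_1 by (intro always_eventually allI divide_right_mono) (auto intro: less_imp_le)
      show "\<forall>\<^sub>F n in sequentially. 0 \<le> frac (P n * x) / P n"
        using Ppos by (intro always_eventually allI divide_nonneg_pos) auto
    qed simp
  qed
  moreover have "real_of_int \<lfloor>P n * x\<rfloor> / P n = x - frac (P n * x) / P n" for n
    using Ppos[of n] by (simp add: frac_def diff_divide_distrib)
  ultimately have "(\<lambda>n. real_of_int \<lfloor>P n * x\<rfloor> / P n - real_of_int \<lfloor>x\<rfloor>) \<longlonglongrightarrow> x - real_of_int \<lfloor>x\<rfloor>"
    by (intro tendsto_diff tendsto_const) simp
  then have "(\<lambda>n. real_of_int (E (Suc n)) / P (Suc n)) sums (x - real_of_int (E 0))"
    unfolding sums_def part by (simp add: E_def)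
  then show ?thesis
    using dig inf unfolding is_cantor_expansion_def P_def
    by (intro exI[of _ E] conjI) (auto simp: E_def)
qed

lemma is_cantor_expansion_cantor_digits:
  assumes "basic_sequence q"
  shows "is_cantor_expansion q x (cantor_digits q x)"
proof -
  obtain E where "is_cantor_expansion q x E"
    using is_cantor_expansion_exists[OF assms] by blast
  then show ?thesis
    unfolding cantor_digits_def by (rule theI[where P = "is_cantor_expansion q x"]) (rule is_cantor_expansion_unique[OF assms _ \<open>is_cantor_expansion q x E\<close>])
qed

section \<open>Orbits, digit ratios and the two types of AP normality\<close>

lemma cantor_tail_near_digit:
  assumes "basic_sequence q" "digit_sequence q E"
  shows "\<bar>cantor_tail q E n - real_of_int (E (Suc n)) / real (q (Suc n))\<bar> \<le> 1 / real (q (Suc n))"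
proof -
  have q: "real (q (Suc n)) > 0" using basic_sequence_pos[OF assms(1)] by simp
  have "cantor_tail q E n - real_of_int (E (Suc n)) / real (q (Suc n)) = cantor_tail q E (Suc n) / real (q (Suc n))"
    using cantor_tail_rec[OF assms, of n] q by (simp add: field_simps)
  then show ?thesis
    using q cantor_tail_bounds[OF assms, of "Suc n"] by (simp add: divide_right_mono)
qed

lemma infinite_in_limit_inverse:
  assumes "infinite_in_limit q" and "filterlim f at_top sequentially"
  shows "(\<lambda>n. 1 / real (q (f n))) \<longlonglongrightarrow> 0"
proof -
  have "filterlim (\<lambda>n. real (q (f n))) at_top sequentially"
    using filterlim_compose[OF filterlim_real_sequentially
        filterlim_compose[OF assms(1)[unfolded infinite_in_limit_def] assms(2)]] .
  then show ?thesis by (intro tendsto_divide_0[OF tendsto_const] filterlim_at_top_imp_at_infinity)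
qed

lemma cantor_tail_tendsto_digit:
  assumes "basic_sequence q" "digit_sequence q E" "infinite_in_limit q"
    and f: "filterlim f at_top sequentially"
  shows "(\<lambda>n. cantor_tail q E (f n) - real_of_int (E (Suc (f n))) / real (q (Suc (f n)))) \<longlonglongrightarrow> 0"
proof (rule Lim_null_comparison)
  show "\<forall>\<^sub>F n in sequentially. norm (cantor_tail q E (f n) - real_of_int (E (Suc (f n))) / real (q (Suc (f n))))
      \<le> 1 / real (q (Suc (f n)))"
    using cantor_tail_near_digit[OF assms(1,2)] by simp
  show "(\<lambda>n. 1 / real (q (Suc (f n)))) \<longlonglongrightarrow> 0"
    using infinite_in_limit_inverse[OF assms(3), of "\<lambda>n. Suc (f n)"]
      filterlim_compose[OF filterlim_Suc f] by simp
qed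

lemma cantor_T_eq_tail:
  assumes "basic_sequence q"
  shows "cantor_T q n x = cantor_tail q (cantor_digits q x) n"
proof -
  note e = is_cantor_expansion_tail[OF assms is_cantor_expansion_cantor_digits[OF assms], of x]
  let ?E = "cantor_digits q x"
  have "real (\<Prod>k=1..n. q k) * x = real (\<Prod>k=1..n. q k) * cantor_value q ?E
      + real_of_int (int (\<Prod>k=1..n. q k) * ?E 0)"
    by (subst e(2)) (simp add: algebra_simps)
  then have "cantor_T q n x = frac (real (\<Prod>k=1..n. q k) * cantor_value q ?E)"
    unfolding cantor_T_def frac_def by (metis add_diff_cancel_right floor_add_int of_int_add)
  also have "\<dots> = cantor_tail q ?E n"
    using e(3)[of n] cantor_tail_bounds(1)[OF assms e(1), of n]
    by (subst frac_prod_cantor_value[OF assms e(1)]) (simp add: frac_eq)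
  finally show ?thesis .
qed

lemma ud_cantor_T_iff_digits:
  assumes "basic_sequence q" "infinite_in_limit q" "filterlim f at_top sequentially"
  shows "ud_mod1 (\<lambda>n. cantor_T q (f n) x) \<longleftrightarrow>
    ud_mod1 (\<lambda>n. real_of_int (cantor_digits q x (Suc (f n))) / real (q (Suc (f n))))"
proof -
  note e = is_cantor_expansion_tail[OF assms(1) is_cantor_expansion_cantor_digits[OF assms(1)], of x]
  have "real_of_int (cantor_digits q x (Suc n)) \<ge> 0" for n
    using e(1) by (auto simp: digit_sequence_def)
  then show ?thesis
    unfolding cantor_T_eq_tail[OF assms(1)]
    by (intro ud_mod1_cong_tendsto cantor_tail_tendsto_digit cantor_tail_bounds(1) e(1) assms
        divide_nonneg_nonneg) auto
qed

text \<open>If the digits are eventually maximal, the tails equal 1 while the fractional parts vanish; then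
  neither side is equidistributed.\<close>

lemma distribution_normal_cantor_value:
  assumes q: "basic_sequence q" "infinite_in_limit q" and E: "digit_sequence q E"
  shows "distribution_normal q (cantor_value q E) \<longleftrightarrow>
    ud_mod1 (\<lambda>n. real_of_int (E (Suc n)) / real (q (Suc n)))"
proof -
  have T: "cantor_T q n (cantor_value q E) = frac (cantor_tail q E n)" for n
    unfolding cantor_T_def by (rule frac_prod_cantor_value[OF q(1) E])
  have E0: "real_of_int (E (Suc n)) / real (q (Suc n)) \<ge> 0" for n
    using E by (intro divide_nonneg_nonneg) (auto simp: digit_sequence_def)
  have tail: "ud_mod1 (cantor_tail q E) \<longleftrightarrow> ud_mod1 (\<lambda>n. real_of_int (E (Suc n)) / real (q (Suc n)))"
    using cantor_tail_tendsto_digit[OF q(1) E q(2), of "\<lambda>n. n"] E0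
    by (intro ud_mod1_cong_tendsto cantor_tail_bounds(1)[OF q(1) E]) (auto simp: filterlim_ident)
  show ?thesis
  proof (cases "\<forall>n. cantor_tail q E n < 1")
    case True
    then have "cantor_T q n (cantor_value q E) = cantor_tail q E n" for n
      using cantor_tail_bounds(1)[OF q(1) E, of n] by (simp add: T frac_eq)
    then show ?thesis unfolding distribution_normal_def tail[symmetric] by simp
  next
    case False
    then obtain N where "cantor_tail q E N = 1"
      using cantor_tail_bounds(2)[OF q(1) E] by (metis less_eq_real_def)
    then have max: "E n = int (q n) - 1" if "n > N" for n
      using cantor_tail_less_1[OF q(1) E _ that] by (metis less_irrefl)
    have one: "cantor_tail q E (N + k) = 1" for k
    proof (induction k)
      case (Suc k)
      then show ?case using cantor_tail_rec[OF q(1) E, of "N + k"] max[of "Suc (N + k)"] by simp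
    qed (simp add: \<open>cantor_tail q E N = 1\<close>)
    then have one': "cantor_tail q E n = 1" if "n \<ge> N" for n
      using that by (metis le_add_diff_inverse)
    have "cantor_tail q E \<longlonglongrightarrow> 1"
      using one' by (intro tendsto_eventually eventually_sequentiallyI)
    then have "\<not> ud_mod1 (cantor_tail q E)"
      by (intro not_ud_mod1_convergent cantor_tail_bounds(1)[OF q(1) E])
    moreover have "(\<lambda>n. cantor_T q n (cantor_value q E)) \<longlonglongrightarrow> 0"
      using one' by (intro tendsto_eventually eventually_sequentiallyI[of N]) (simp add: T)
    then have "\<not> distribution_normal q (cantor_value q E)"
      unfolding distribution_normal_def by (intro not_ud_mod1_convergent) (auto simp: T)
    ultimately show ?thesis using tail by blast
  qed
qed

lemma filterlim_arith_progression:
  assumes "(m::nat) \<ge> 1" shows "filterlim (\<lambda>n. m * n + r) at_top sequentially"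
proof (rule filterlim_at_top_mono[OF filterlim_ident])
  show "\<forall>\<^sub>F n in sequentially. n \<le> m * n + r"
    using assms by (intro always_eventually allI) (metis le_add1 mult_le_mono1 nat_mult_1 order_trans)
qed

lemma AP_index_Suc: "AP_index m r (Suc n) = (if r = 0 then m * n + m else m * n + r)"
  by (simp add: AP_index_def)

text \<open>Orbit time mn + r reads the digit at position mn + r + 1, so type I for class r is type
  II for class r + 1 modulo m. Class m - 1 goes to class 0, whose positions start at m as in
  \<open>AP_index\<close>; the quantifier over r absorbs the shift.\<close>

lemma AP_distribution_normal_I_iff_II:
  assumes q: "basic_sequence q" "infinite_in_limit q"
  shows "AP_distribution_normal_I q x \<longleftrightarrow> AP_distribution_normal_II q x"
proof -
  define e where "e = (\<lambda>n. real_of_int (cantor_digits q x n) / real (q n))"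
  have I: "AP_distribution_normal_I q x \<longleftrightarrow> (\<forall>m\<ge>1. \<forall>r<m. ud_mod1 (\<lambda>n. e (Suc (m * n + r))))"
    unfolding AP_distribution_normal_I_def e_def
    using ud_cantor_T_iff_digits[OF q filterlim_arith_progression] by simp
  have dig: "digit_sequence q (cantor_digits q x)"
    by (rule is_cantor_expansion_tail[OF q(1) is_cantor_expansion_cantor_digits[OF q(1)]])
  have "distribution_normal (\<lambda>n. q (AP_index m r n))
          (cantor_value (\<lambda>n. q (AP_index m r n)) (\<lambda>n. cantor_digits q x (AP_index m r n)))
       \<longleftrightarrow> ud_mod1 (\<lambda>n. e (AP_index m r (Suc n)))" if "m \<ge> 1" "r < m" for m r
  proof -
    have pos: "AP_index m r n \<ge> 1" if "n \<ge> 1" for n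
      using that \<open>m \<ge> 1\<close> by (auto simp: AP_index_def)
    have "filterlim (AP_index m r) at_top sequentially"
    proof -
      have "filterlim (\<lambda>n. AP_index m r (Suc n)) at_top sequentially"
        using filterlim_arith_progression[OF that(1)] by (cases "r = 0") (simp_all add: AP_index_Suc)
      then show ?thesis by (simp add: filterlim_sequentially_Suc)
    qed
    then have "infinite_in_limit (\<lambda>n. q (AP_index m r n))"
      using q(2) unfolding infinite_in_limit_def by (rule filterlim_compose[rotated])
    then show ?thesis unfolding e_def
      using pos q(1) dig
      by (intro distribution_normal_cantor_value) (auto simp: basic_sequence_def digit_sequence_def)
  qed
  then have II: "AP_distribution_normal_II q x \<longleftrightarrow> (\<forall>m\<ge>1. \<forall>r<m. ud_mod1 (\<lambda>n. e (AP_index m r (Suc n))))"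
    unfolding AP_distribution_normal_II_def by simp
  show ?thesis
    unfolding I II
  proof (intro iffI allI impI)
    fix m r :: nat assume *: "\<forall>m\<ge>1. \<forall>r<m. ud_mod1 (\<lambda>n. e (Suc (m * n + r)))" "1 \<le> m" "r < m"
    show "ud_mod1 (\<lambda>n. e (AP_index m r (Suc n)))"
    proof (cases r)
      case 0
      then show ?thesis using *(1)[rule_format, of m "m - 1"] *(2) by (simp add: AP_index_Suc)
    next
      case (Suc r')
      then show ?thesis using *(1)[rule_format, of m r'] *(2,3) by (simp add: AP_index_Suc)
    qed
  next
    fix m r :: nat assume *: "\<forall>m\<ge>1. \<forall>r<m. ud_mod1 (\<lambda>n. e (AP_index m r (Suc n)))" "1 \<le> m" "r < m"
    show "ud_mod1 (\<lambda>n. e (Suc (m * n + r)))"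
    proof (cases "Suc r = m")
      case True
      then show ?thesis using *(1)[rule_format, of m 0] *(2) by (simp add: AP_index_Suc flip: True)
    next
      case False
      then show ?thesis using *(1)[rule_format, of m "Suc r"] *(2,3) by (simp add: AP_index_Suc)
    qed
  qed
qed

section \<open>Meagreness\<close>

text \<open>\<open>meagre\<close> asks for equality with a union of nowhere dense sets; intersecting
  the covering sets with S provides it.\<close>

lemma meagreI_subset:
  assumes "\<And>i. nowhere_dense (A i)" and "S \<subseteq> (\<Union>i::nat. A i)"
  shows "meagre S"
proof -
  have "nowhere_dense (S \<inter> A i)" for i
    using assms(1)[of i] interior_mono[OF closure_mono[of "S \<inter> A i" "A i"]]
    by (auto simp: nowhere_dense_def)
  moreover have "S = (\<Union>i. S \<inter> A i)" using assms(2) by auto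
  ultimately show ?thesis unfolding meagre_def by (intro exI[of _ "\<lambda>i. S \<inter> A i"]) auto
qed

lemma prod_less_le_double:
  assumes "basic_sequence q" "i < j"
  shows "2 * (\<Prod>k=1..i. q k) \<le> (\<Prod>k=1..j. q k)"
  using assms(2)
proof (induction j)
  case (Suc j)
  have q: "2 \<le> q (Suc j)" using assms(1) by (simp add: basic_sequence_def)
  have "2 * (\<Prod>k=1..j. q k) \<le> q (Suc j) * (\<Prod>k=1..j. q k)"
    using q by (rule mult_right_mono) simp
  then have *: "2 * (\<Prod>k=1..j. q k) \<le> (\<Prod>k=1..Suc j. q k)"
    by (simp add: mult.commute)
  show ?case
  proof (cases "i = j")
    case False
    then show ?thesis using Suc * by linarith
  qed (use * in simp)
qed simp

text \<open>Every cylinder contains a subinterval whose points have all digits equal to zero over a stretch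
  that is long compared with everything before it.\<close>

lemma nowhere_dense_bounded_frequency:
  assumes q: "basic_sequence q"
  shows "nowhere_dense {x. \<forall>n\<ge>N. real (card {i. i < n \<and> cantor_T q i x \<in> {0..<1/2}}) / real n < 3/4}"
    (is "nowhere_dense ?A")
  unfolding nowhere_dense_def
proof (rule ccontr)
  assume "interior (closure ?A) \<noteq> {}"
  then obtain w where "w \<in> interior (closure ?A)" by blast
  then obtain e where e: "e > 0" "ball w e \<subseteq> closure ?A" by (auto simp: mem_interior)
  define P where "P = (\<lambda>n. real (\<Prod>k=1..n. q k))"
  have Ppos: "P n > 0" for n
    unfolding P_def using basic_sequence_prod_pos[OF q, of n] by linarith
  have "\<forall>\<^sub>F n in sequentially. 1 / P n < e"
    using inverse_prod_tendsto_0[OF q] e(1) unfolding P_def by (rule order_tendstoD)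
  then obtain k where k: "1 / P k < e" by (auto simp: eventually_sequentially)
  \<comment> \<open>As M \<ge> 4 k, the times in [k, M) make up at least three quarters of [0, M);
    the other summands give M \<ge> N and M > 0.\<close>
  define M where "M = 4 * k + N + 4"
  \<comment> \<open>The left end of the level-k cylinder containing w. For i \<ge> k the number P i
    * b is an integer, so the orbit point at time i depends only on x - b.\<close>
  define b where "b = real_of_int \<lfloor>P k * w\<rfloor> / P k"
  have b: "b \<le> w" "w < b + e"
  proof -
    have "real_of_int \<lfloor>P k * w\<rfloor> \<le> w * P k" by (simp add: mult.commute)
    then show "b \<le> w" unfolding b_def using Ppos[of k] by (simp add: divide_le_eq)
    have "P k * w < real_of_int \<lfloor>P k * w\<rfloor> + 1" by linarith
    then have "w < (real_of_int \<lfloor>P k * w\<rfloor> + 1) / P k"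
      using Ppos[of k] by (simp add: less_divide_eq mult.commute)
    then show "w < b + e" using k by (simp add: b_def add_divide_distrib)
  qed
  \<comment> \<open>The first bound makes P i * (x - b) < 1/2 for all i < M, the second keeps the
    interval inside the ball.\<close>
  define h where "h = min (1 / P M) (e - (w - b))"
  have h: "h > 0" "h \<le> 1 / P M" using Ppos[of M] b by (auto simp: h_def)
  have "{b<..<b + h} \<subseteq> ball w e"
    using b e(1) by (auto simp: h_def dist_real_def)
  then have "{b<..<b + h} \<subseteq> closure ?A" using e(2) by blast
  moreover have "{b<..<b + h} \<noteq> {}" using h(1) by simp
  ultimately have "{b<..<b + h} \<inter> closure ?A \<noteq> {}" by (simp only: inf.absorb1 not_False_eq_True)
  then have "{b<..<b + h} \<inter> ?A \<noteq> {}"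
    unfolding open_Int_closure_eq_empty[OF open_greaterThanLessThan] .
  then obtain x where "x \<in> {b<..<b + h}" "x \<in> ?A" by blast
  then have x: "b < x" "x < b + h"
    "\<And>n. n \<ge> N \<Longrightarrow> real (card {i. i < n \<and> cantor_T q i x \<in> {0..<1/2}}) / real n < 3/4"
    by simp_all
  have "cantor_T q i x \<in> {0..<1/2}" if "i \<in> {k..<M}" for i
  proof -
    have i: "k \<le> i" "i < M" using that by auto
    have "(\<Prod>k=1..k. q k) dvd (\<Prod>k=1..i. q k)" using i by (intro prod_dvd_prod_subset) auto
    then obtain c where "(\<Prod>k=1..i. q k) = (\<Prod>k=1..k. q k) * c" by blast
    then have c: "P i = P k * real c" unfolding P_def by (simp only: of_nat_mult)
    have "P i * x = real_of_int (int c * \<lfloor>P k * w\<rfloor>) + P i * (x - b)"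
      unfolding c b_def using Ppos[of k] by (simp add: field_simps)
    then have T: "cantor_T q i x = frac (P i * (x - b))"
      unfolding cantor_T_def P_def by (simp only: frac_add_of_int_left)
    have "P i * (x - b) < P i * (1 / P M)"
      using x h Ppos[of i] by (intro mult_strict_left_mono) auto
    also have "\<dots> \<le> 1 / 2"
    proof -
      have "2 * P i \<le> P M"
        using prod_less_le_double[OF q i(2)] unfolding P_def
        by (metis of_nat_le_iff of_nat_mult of_nat_numeral)
      then show ?thesis using Ppos[of M] by (simp add: field_simps)
    qed
    finally have "P i * (x - b) < 1 / 2" .
    moreover have "P i * (x - b) \<ge> 0" using x Ppos[of i] by simp
    ultimately show ?thesis unfolding T by (simp add: frac_eq[THEN iffD2])
  qed
  then have "card {k..<M} \<le> card {i. i < M \<and> cantor_T q i x \<in> {0..<1/2}}"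
    by (intro card_mono) auto
  then have "real M - real k \<le> real (card {i. i < M \<and> cantor_T q i x \<in> {0..<1/2}})"
    by simp
  moreover have "real (card {i. i < M \<and> cantor_T q i x \<in> {0..<1/2}}) / real M < 3/4"
    by (rule x(3)) (simp add: M_def)
  then have "real (card {i. i < M \<and> cantor_T q i x \<in> {0..<1/2}}) < 3/4 * real M"
    by (simp add: divide_less_eq M_def)
  ultimately show False by (simp add: M_def)
qed

lemma meagre_distribution_normal:
  assumes "basic_sequence q" and "S \<subseteq> {x. distribution_normal q x}"
  shows "meagre S"
proof (rule meagreI_subset[OF nowhere_dense_bounded_frequency[OF assms(1)]])
  show "S \<subseteq> (\<Union>N. {x. \<forall>n\<ge>N. real (card {i. i < n \<and> cantor_T q i x \<in> {0..<1/2}}) / real n < 3/4})"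
  proof
    fix x assume "x \<in> S"
    then have "(\<lambda>n. real (card {i. i < n \<and> cantor_T q i x \<in> {0..<1/2}}) / real n) \<longlonglongrightarrow> 1/2"
    proof -
      have "distribution_normal q x" using \<open>x \<in> S\<close> assms(2) by blast
      then show ?thesis
        unfolding distribution_normal_def ud_mod1_def by (rule bspec) simp
    qed
    then have "\<forall>\<^sub>F n in sequentially. real (card {i. i < n \<and> cantor_T q i x \<in> {0..<1/2}}) / real n < 3/4"
      by (rule order_tendstoD) simp
    then show "x \<in> (\<Union>N. {x. \<forall>n\<ge>N. real (card {i. i < n \<and> cantor_T q i x \<in> {0..<1/2}}) / real n < 3/4})"
      by (auto simp: eventually_sequentially)
  qed
qed

section \<open>Almost sure uniform distribution\<close>

text \<open>For k^2 \<le> n < (k+1)^2 the sums up to n and up to k^2 differ by at most 2 k, which is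
  2 / k relative to k^2. The passage to squares is what makes variance bounds of order 1 / n
  summable.\<close>

lemma averages_tendsto_0_of_squares:
  fixes a :: "nat \<Rightarrow> real"
  assumes a: "\<And>i. \<bar>a i\<bar> \<le> 1"
    and lim: "(\<lambda>k. (\<Sum>i<k\<^sup>2. a i) / real (k\<^sup>2)) \<longlonglongrightarrow> 0"
  shows "(\<lambda>n. (\<Sum>i<n. a i) / real n) \<longlonglongrightarrow> 0"
proof -
  define S where "S = (\<lambda>n. \<Sum>i<n. a i)"
  define f where "f = (\<lambda>k. \<bar>S (k\<^sup>2) / real (k\<^sup>2)\<bar> + 2 / real k)"
  define r where "r = (\<lambda>n. nat \<lfloor>sqrt (real n)\<rfloor>)"
  have "f \<longlonglongrightarrow> 0 + 0"
    unfolding f_def S_def by (intro tendsto_add tendsto_rabs_zero lim lim_const_over_n)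
  moreover have "filterlim r at_top sequentially"
    unfolding r_def
    by (intro filterlim_compose[OF filterlim_nat_sequentially]
        filterlim_compose[OF filterlim_floor_sequentially] filterlim_compose[OF sqrt_at_top]
        filterlim_real_sequentially)
  ultimately have fr: "(\<lambda>n. f (r n)) \<longlonglongrightarrow> 0"
    using filterlim_compose by fastforce
  have "norm (S n / real n) \<le> f (r n)" if n: "n > 0" for n
  proof -
    let ?k = "r n"
    have "1 \<le> sqrt (real n)" using n by simp
    then have k1: "?k \<ge> 1" unfolding r_def by (simp add: le_nat_floor)
    have "real ?k \<le> sqrt (real n)" "sqrt (real n) < real ?k + 1"
      unfolding r_def by (auto simp: of_nat_floor)
    then have "(real ?k)\<^sup>2 \<le> (sqrt (real n))\<^sup>2" "(sqrt (real n))\<^sup>2 < (real ?k + 1)\<^sup>2"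
      by (intro power_mono power_strict_mono; simp)+
    then have k: "(real ?k)\<^sup>2 \<le> real n" "real n < (real ?k + 1)\<^sup>2" by simp_all
    then have kn: "?k\<^sup>2 \<le> n" by (metis of_nat_le_iff of_nat_power)
    have "S n = S (?k\<^sup>2) + (\<Sum>i=?k\<^sup>2..<n. a i)"
      unfolding S_def using kn by (metis sum.atLeastLessThan_concat lessThan_atLeast0 le0)
    moreover have "\<bar>\<Sum>i=?k\<^sup>2..<n. a i\<bar> \<le> (\<Sum>i=?k\<^sup>2..<n. 1)"
      using a by (intro order_trans[OF sum_abs] sum_mono) auto
    moreover have "(\<Sum>i=?k\<^sup>2..<n. 1) = real n - (real ?k)\<^sup>2"
      using kn by (simp add: of_nat_diff)
    moreover have "real n - (real ?k)\<^sup>2 \<le> 2 * real ?k"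
    proof -
      have "real n < (real ?k)\<^sup>2 + 2 * real ?k + 1" using k(2) by (simp add: power2_sum)
      then have "n < ?k\<^sup>2 + 2 * ?k + 1"
        by (metis (no_types, lifting) of_nat_1 of_nat_add of_nat_less_iff of_nat_mult of_nat_numeral of_nat_power)
      then have "n \<le> ?k\<^sup>2 + 2 * ?k" by simp
      then have "real n \<le> (real ?k)\<^sup>2 + 2 * real ?k"
        by (metis (no_types, lifting) of_nat_add of_nat_le_iff of_nat_mult of_nat_numeral of_nat_power)
      then show ?thesis by simp
    qed
    ultimately have "\<bar>S n\<bar> \<le> \<bar>S (?k\<^sup>2)\<bar> + 2 * real ?k" by linarith
    then have "\<bar>S n\<bar> / real n \<le> (\<bar>S (?k\<^sup>2)\<bar> + 2 * real ?k) / real n"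
      by (rule divide_right_mono) simp
    also have "\<dots> \<le> (\<bar>S (?k\<^sup>2)\<bar> + 2 * real ?k) / (real ?k)\<^sup>2"
      using k k1 n by (intro divide_left_mono) auto
    also have "\<dots> = f ?k"
      using k1 by (simp add: f_def add_divide_distrib power2_eq_square)
    finally show ?thesis by simp
  qed
  then have "\<forall>\<^sub>F n in sequentially. norm (S n / real n) \<le> f (r n)"
    by (intro eventually_mono[OF eventually_gt_at_top[of 0]])
  from Lim_null_comparison[OF this fr] show ?thesis by (simp add: S_def)
qed

text \<open>Enlarging the square by one adds a row, a column and a corner. Each contributes at most
  c, the first two by the geometric series 1/2 + 1/4 + ...\<close>

lemma double_sum_correlation_le:
  fixes r :: "nat \<Rightarrow> nat \<Rightarrow> real"
  assumes r: "\<And>i j. i \<le> j \<Longrightarrow> r i j \<le> c * (1/2) ^ (j - i)" and sym: "\<And>i j. r i j = r j i"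
    and c: "c \<ge> 0"
  shows "(\<Sum>i<n. \<Sum>j<n. r i j) \<le> 3 * c * real n"
proof (induction n)
  case (Suc n)
  have row: "(\<Sum>i<n. r i n) \<le> c"
  proof -
    have "(\<Sum>i<n. r i n) \<le> (\<Sum>i<n. c * (1/2) ^ (n - i))" by (intro sum_mono r) auto
    also have "\<dots> = c * (\<Sum>i<n. (1/2) ^ (n - i))" by (simp add: sum_distrib_left)
    also have "(\<Sum>i<n. (1/2::real) ^ (n - i)) = (\<Sum>i<n. (1/2) ^ Suc i)"
      by (subst sum.nat_diff_reindex[symmetric], rule sum.cong) (auto simp: Suc_diff_Suc)
    also have "\<dots> = 1 - (1/2) ^ n"
      by (induction n) (auto simp: field_simps)
    also have "c * (1 - (1/2) ^ n) \<le> c" using mult_left_mono[OF _ c, of "1 - (1/2) ^ n" 1] by simp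
    finally show ?thesis .
  qed
  have "(\<Sum>i<Suc n. \<Sum>j<Suc n. r i j)
      = (\<Sum>i<n. \<Sum>j<n. r i j) + (\<Sum>i<n. r i n) + (\<Sum>j<n. r n j) + r n n"
    by (simp add: sum.distrib)
  also have "(\<Sum>j<n. r n j) = (\<Sum>i<n. r i n)" by (simp add: sym)
  also have "r n n \<le> c" using r[of n n] by simp
  finally show ?case using Suc row by (simp add: algebra_simps)
qed simp

text \<open>The second moment of S n / n is at most 3 c / n. Along squares these moments are
  summable, so the series of the squared averages has finite integral, converges almost everywhere,
  and its terms tend to 0. A one-sided bound on the correlations controls the variance.\<close>

lemma (in finite_measure) AE_frequency_tendsto:
  fixes A :: "nat \<Rightarrow> 'a set" and t c :: real
  assumes total: "measure M (space M) = 1"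
    and A [measurable]: "\<And>i. A i \<in> sets M"
    and mean: "\<And>i. measure M (A i) = t"
    and corr: "\<And>i j. i \<le> j \<Longrightarrow> measure M (A i \<inter> A j) - t\<^sup>2 \<le> c * (1/2) ^ (j - i)"
    and c: "c \<ge> 0"
  shows "AE x in M. (\<lambda>n. real (card {i. i < n \<and> x \<in> A i}) / real n) \<longlonglongrightarrow> t"
proof -
  define g where "g = (\<lambda>i x. indicat_real (A i) x - t)"
  define S where "S = (\<lambda>n x. \<Sum>i<n. g i x)"
  have t: "0 \<le> t" "t \<le> 1"
    using mean[of 0, symmetric] bounded_measure[of "A 0"] total by auto
  have [measurable]: "g i \<in> borel_measurable M" for i unfolding g_def by measurable
  have [measurable]: "S n \<in> borel_measurable M" for n unfolding S_def by measurable
  have g1: "\<bar>g i x\<bar> \<le> 1" for i x using t by (auto simp: g_def indicator_def)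
  have int_gg: "integrable M (\<lambda>x. g i x * g j x)" for i j
    using g1 by (intro integrable_const_bound[where B = 1] AE_I2) (auto simp: abs_mult intro!: mult_le_one)
  have gg: "(\<integral>x. g i x * g j x \<partial>M) = measure M (A i \<inter> A j) - t\<^sup>2" for i j
  proof -
    have "(\<lambda>x. g i x * g j x)
        = (\<lambda>x. indicat_real (A i \<inter> A j) x - t * indicat_real (A i) x - t * indicat_real (A j) x + t\<^sup>2)"
      by (auto simp: g_def indicator_inter_arith algebra_simps power2_eq_square)
    moreover have "integrable M (indicat_real B)" if "B \<in> sets M" for B
      using that by (intro integrable_real_indicator) (auto simp: emeasure_eq_measure)
    ultimately have "(\<integral>x. g i x * g j x \<partial>M)
       = measure M (A i \<inter> A j) - t * measure M (A i) - t * measure M (A j) + t\<^sup>2 * measure M (space M)"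
      by simp
    then show ?thesis by (simp add: mean total power2_eq_square)
  qed
  have S2: "(\<lambda>x. (S n x)\<^sup>2) = (\<lambda>x. \<Sum>i<n. \<Sum>j<n. g i x * g j x)" for n
    by (auto simp: S_def power2_eq_square sum_product)
  have intS: "integrable M (\<lambda>x. (S n x)\<^sup>2)" for n
    unfolding S2 by (intro Bochner_Integration.integrable_sum int_gg)
  have var: "(\<integral>x. (S n x)\<^sup>2 \<partial>M) \<le> 3 * c * real n" for n
  proof -
    have "(\<integral>x. (S n x)\<^sup>2 \<partial>M) = (\<Sum>i<n. \<Sum>j<n. measure M (A i \<inter> A j) - t\<^sup>2)"
      unfolding S2 by (simp add: int_gg gg Bochner_Integration.integral_sum)
    also have "\<dots> \<le> 3 * c * real n"
      by (rule double_sum_correlation_le[OF corr _ c]) (auto simp: Int_commute)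
    finally show ?thesis .
  qed
  define h where "h = (\<lambda>k x. (S ((Suc k)\<^sup>2) x / real ((Suc k)\<^sup>2))\<^sup>2)"
  have [measurable]: "h k \<in> borel_measurable M" for k unfolding h_def by measurable
  have h0: "h k x \<ge> 0" for k x by (simp add: h_def)
  have h: "(\<integral>\<^sup>+x. ennreal (h k x) \<partial>M) \<le> ennreal (3 * c * (1 / (real (Suc k))\<^sup>2))" for k
  proof -
    have hk: "h k = (\<lambda>x. (S ((Suc k)\<^sup>2) x)\<^sup>2 / (real ((Suc k)\<^sup>2))\<^sup>2)"
      by (simp add: h_def power_divide)
    have int: "integrable M (h k)" unfolding hk by (intro integrable_divide intS)
    have "(\<integral>\<^sup>+x. ennreal (h k x) \<partial>M) = ennreal (\<integral>x. h k x \<partial>M)"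
      using int h0 by (intro nn_integral_eq_integral) auto
    also have "(\<integral>x. h k x \<partial>M) \<le> 3 * c * real ((Suc k)\<^sup>2) / (real ((Suc k)\<^sup>2))\<^sup>2"
      unfolding hk by (simp del: of_nat_power) (intro divide_right_mono var; simp)
    also have "\<dots> = 3 * c * (1 / (real (Suc k))\<^sup>2)"
      unfolding of_nat_power by (simp add: power2_eq_square del: of_nat_Suc)
    finally show ?thesis by (simp add: ennreal_leI)
  qed
  have "(\<integral>\<^sup>+x. (\<Sum>k. ennreal (h k x)) \<partial>M) = (\<Sum>k. \<integral>\<^sup>+x. ennreal (h k x) \<partial>M)"
    by (intro nn_integral_suminf) simp
  also have "\<dots> \<le> (\<Sum>k. ennreal (3 * c * (1 / (real (Suc k))\<^sup>2)))"
    by (intro suminf_le h summableI)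
  also have "\<dots> < \<infinity>"
  proof -
    have "summable (\<lambda>k. 3 * c * (1 / (real (Suc k))\<^sup>2))"
      using inverse_squares_sums by (intro summable_mult) (auto simp: sums_iff add.commute)
    then have "(\<Sum>k. ennreal (3 * c * (1 / (real (Suc k))\<^sup>2))) = ennreal (\<Sum>k. 3 * c * (1 / (real (Suc k))\<^sup>2))"
      using c by (intro suminf_ennreal2) auto
    then show ?thesis by simp
  qed
  finally have "AE x in M. (\<Sum>k. ennreal (h k x)) \<noteq> \<infinity>"
    by (intro nn_integral_noteq_infinite) auto
  then show ?thesis
  proof (eventually_elim)
    case (elim x)
    then have "summable (\<lambda>k. h k x)"
      using h0 by (intro summable_suminf_not_top) auto
    then have "(\<lambda>k. h k x) \<longlonglongrightarrow> 0" by (rule summable_LIMSEQ_zero)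
    then have "(\<lambda>k. S ((Suc k)\<^sup>2) x / real ((Suc k)\<^sup>2)) \<longlonglongrightarrow> 0"
      unfolding h_def by (simp add: power_tendsto_0_iff)
    then have "(\<lambda>k. S (k\<^sup>2) x / real (k\<^sup>2)) \<longlonglongrightarrow> 0"
      by (rule LIMSEQ_imp_Suc)
    then have "(\<lambda>n. S n x / real n) \<longlonglongrightarrow> 0"
      unfolding S_def by (intro averages_tendsto_0_of_squares g1)
    then have "(\<lambda>n. S n x / real n + t) \<longlonglongrightarrow> 0 + t" by (intro tendsto_add tendsto_const)
    moreover have "\<forall>\<^sub>F n in sequentially. S n x / real n + t = real (card {i. i < n \<and> x \<in> A i}) / real n"
    proof (intro eventually_mono[OF eventually_gt_at_top[of 0]])
      fix n :: nat assume n: "n > 0"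
      have "(\<Sum>i<n. indicat_real (A i) x) = real (card {i. i < n \<and> x \<in> A i})"
        by (simp add: indicator_def sum.If_cases Int_def conj_commute)
      then show "S n x / real n + t = real (card {i. i < n \<and> x \<in> A i}) / real n"
        using n by (simp add: S_def g_def sum_subtractf diff_divide_distrib)
    qed
    ultimately show ?case using Lim_transform_eventually by fastforce
  qed
qed

text \<open>Frequencies are monotone in t and the rationals are dense. This leaves countably many
  conditions, each of which may have its own exceptional null set.\<close>

lemma ud_mod1I_Rats:
  fixes s :: "nat \<Rightarrow> real"
  assumes "\<And>t. t \<in> \<rat> \<inter> {0..1} \<Longrightarrow>
    (\<lambda>n. real (card {i. i < n \<and> s i \<in> {0..<t}}) / real n) \<longlonglongrightarrow> t"
  shows "ud_mod1 s"
  unfolding ud_mod1_def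
proof
  fix t :: real assume t: "t \<in> {0..1}"
  define f where "f = (\<lambda>t n. real (card {i. i < n \<and> s i \<in> {0..<t}}) / real n)"
  have mono: "f u n \<le> f v n" if "u \<le> v" for u v n
    unfolding f_def using that by (intro divide_right_mono of_nat_mono card_mono) auto
  have f: "f u \<longlonglongrightarrow> u" if "u \<in> \<rat> \<inter> {0..1}" for u using assms[OF that] by (simp add: f_def)
  have "f t \<longlonglongrightarrow> t"
  proof (rule order_tendstoI)
    fix a assume "a < t"
    show "\<forall>\<^sub>F n in sequentially. a < f t n"
    proof (cases "a < 0")
      case True
      then show ?thesis by (intro always_eventually allI) (auto simp: f_def intro: less_le_trans)
    next
      case False
      obtain u where u: "u \<in> \<rat>" "a < u" "u < t" using Rats_dense_in_real[OF \<open>a < t\<close>] by blast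
      then have "\<forall>\<^sub>F n in sequentially. a < f u n"
        using f[of u] t False by (intro order_tendstoD) auto
      then show ?thesis by eventually_elim (use mono[of u t] u in \<open>auto intro: less_le_trans\<close>)
    qed
  next
    fix a assume "t < a"
    show "\<forall>\<^sub>F n in sequentially. f t n < a"
    proof (cases "a > 1")
      case True
      have "f t n \<le> 1" for n
        using card_mono[of "{..<n}" "{i. i < n \<and> s i \<in> {0..<t}}"]
        by (cases "n = 0") (auto simp: f_def divide_le_eq_1)
      then show ?thesis using True by (intro always_eventually allI) (auto intro: le_less_trans)
    next
      case False
      obtain u where u: "u \<in> \<rat>" "t < u" "u < a" using Rats_dense_in_real[OF \<open>t < a\<close>] by blast
      then have "\<forall>\<^sub>F n in sequentially. f u n < a"
        using f[of u] t False by (intro order_tendstoD) auto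
      then show ?thesis by eventually_elim (use mono[of t u] u in \<open>auto intro: le_less_trans\<close>)
    qed
  qed
  then show "(\<lambda>n. real (card {i. i < n \<and> s i \<in> {0..<t}}) / real n) \<longlonglongrightarrow> t" by (simp add: f_def)
qed

section \<open>Lacunary integer multiples modulo 1\<close>

text \<open>For K > 0 and 0 \<le> t \<le> 1 this is the union of the intervals [n/K, (n+t)/K) over
  all integers n.\<close>

definition frac_below :: "nat \<Rightarrow> real \<Rightarrow> real set" where
  "frac_below K t = {x. frac (real K * x) < t}"

lemma frac_below_measurable [measurable]: "frac_below K t \<in> sets borel"
proof -
  have [measurable]: "(\<lambda>x. frac (real K * x)) \<in> borel_measurable borel"
    unfolding frac_def by measurable
  show ?thesis unfolding frac_below_def by measurable
qed

lemma frac_below_cell: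
  assumes "K > 0" "0 \<le> t" "t \<le> 1"
  shows "frac_below K t \<inter> {real n / real K..<real (Suc n) / real K}
    = {real n / real K..<(real n + t) / real K}"
proof -
  have K: "real K > 0" using assms(1) by simp
  have fr: "frac (real K * x) = real K * x - real n" if "real n / real K \<le> x" "x < real (Suc n) / real K" for x
  proof -
    have "real n \<le> real K * x" "real K * x < real n + 1"
      using that K by (simp_all add: divide_le_eq less_divide_eq mult.commute add.commute)
    then have "\<lfloor>real K * x\<rfloor> = int n" by (simp add: floor_eq_iff)
    then show ?thesis by (simp add: frac_def)
  qed
  have le: "(real n + t) / real K \<le> real (Suc n) / real K"
    using assms K by (intro divide_right_mono) auto
  show ?thesis
  proof (intro equalityI subsetI)
    fix x assume x: "x \<in> frac_below K t \<inter> {real n / real K..<real (Suc n) / real K}"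
    then have "real K * x - real n < t" using fr[of x] by (auto simp: frac_below_def)
    then have "x < (real n + t) / real K" using K by (simp add: less_divide_eq mult.commute)
    with x show "x \<in> {real n / real K..<(real n + t) / real K}" by simp
  next
    fix x assume x: "x \<in> {real n / real K..<(real n + t) / real K}"
    then have x': "real n / real K \<le> x" "x < real (Suc n) / real K" using le by auto
    have "real K * x - real n < t" using x K by (simp add: less_divide_eq mult.commute algebra_simps)
    then show "x \<in> frac_below K t \<inter> {real n / real K..<real (Suc n) / real K}"
      using x' fr[OF x'] by (auto simp: frac_below_def)
  qed
qed

lemma measure_Ico_split:
  fixes A :: "real set" and a b c :: real
  assumes [measurable]: "A \<in> sets borel" and "a \<le> b" "b \<le> c"
  shows "measure lborel (A \<inter> {a..<c}) = measure lborel (A \<inter> {a..<b}) + measure lborel (A \<inter> {b..<c})"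
proof -
  have fin: "emeasure lborel (A \<inter> {u..<v}) \<noteq> \<infinity>" for u v :: real
  proof -
    have "emeasure lborel (A \<inter> {u..<v}) \<le> emeasure lborel {u..v}" by (intro emeasure_mono) auto
    also have "\<dots> < \<infinity>" by (simp add: emeasure_lborel_Icc_eq)
    finally show ?thesis by simp
  qed
  have "A \<inter> {a..<c} = (A \<inter> {a..<b}) \<union> (A \<inter> {b..<c})" using assms by auto
  then show ?thesis using fin by (simp only:) (intro measure_Union; auto)
qed

lemma measure_Ico_mono:
  fixes A :: "real set" and a b c :: real
  assumes "A \<in> sets borel" and "a \<le> b" "b \<le> c"
  shows "measure lborel (A \<inter> {a..<b}) \<le> measure lborel (A \<inter> {a..<c})"
  using measure_Ico_split[OF assms] by (simp add: measure_nonneg)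

lemma measure_frac_below_grid:
  assumes "K > 0" "0 \<le> t" "t \<le> 1"
  shows "measure lborel (frac_below K t \<inter> {0..<real n / real K}) = t * (real n / real K)"
proof (induction n)
  case (Suc n)
  have "measure lborel (frac_below K t \<inter> {0..<real (Suc n) / real K})
    = measure lborel (frac_below K t \<inter> {0..<real n / real K})
      + measure lborel (frac_below K t \<inter> {real n / real K..<real (Suc n) / real K})"
    by (intro measure_Ico_split) (auto simp: divide_right_mono)
  also have "\<dots> = t * (real n / real K) + t / real K"
    using assms by (simp only: Suc frac_below_cell[OF assms]) (simp add: divide_right_mono add_divide_distrib)
  finally show ?case by (simp add: add_divide_distrib distrib_left)
qed simp

lemma measure_frac_below_le:
  assumes K: "K > 0" and t: "0 \<le> t" "t \<le> 1" and b: "b \<ge> 0"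
  shows "\<bar>measure lborel (frac_below K t \<inter> {0..<b}) - t * b\<bar> \<le> 1 / real K"
proof -
  define n where "n = nat \<lfloor>real K * b\<rfloor>"
  have "real n \<le> real K * b" "real K * b < real (Suc n)"
    using b unfolding n_def by (auto simp: of_nat_floor) linarith
  then have n: "real n / real K \<le> b" "b \<le> real (Suc n) / real K"
    using K by (auto simp: divide_le_eq le_divide_eq mult.commute)
  have "t * (real n / real K) \<le> measure lborel (frac_below K t \<inter> {0..<b})"
    unfolding measure_frac_below_grid[OF K t, symmetric] using n by (intro measure_Ico_mono) auto
  moreover have "measure lborel (frac_below K t \<inter> {0..<b}) \<le> t * (real (Suc n) / real K)"
    unfolding measure_frac_below_grid[OF K t, symmetric] using n b by (intro measure_Ico_mono) auto
  moreover have "t * (real n / real K) \<le> t * b" "t * b \<le> t * (real (Suc n) / real K)"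
    using mult_left_mono[OF n(1) t(1)] mult_left_mono[OF n(2) t(1)] by simp_all
  moreover have "t * (real (Suc n) / real K) = t * (real n / real K) + t / real K"
    by (simp add: add_divide_distrib distrib_left)
  moreover have "t / real K \<le> 1 / real K" using t by (intro divide_right_mono) auto
  ultimately show ?thesis by linarith
qed

text \<open>In one cell of the R-grid the first event is an interval of length t / R. The second
  fills it in proportion t, with an error of at most 1 / K from either endpoint: at most t^2 / R + 2
  / K per cell, whether or not R divides K.\<close>

lemma measure_frac_below_inter_le:
  assumes R: "R > 0" and K: "K > 0" and t: "0 \<le> t" "t \<le> 1"
  shows "measure lborel (frac_below R t \<inter> frac_below K t \<inter> {0..<real n / real R})
    \<le> t\<^sup>2 * (real n / real R) + 2 * real n / real K"
proof (induction n)
  case (Suc n)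
  let ?a = "real n / real R" and ?b = "(real n + t) / real R"
  have ab: "?a \<le> ?b" using t by (intro divide_right_mono) auto
  have cell: "frac_below R t \<inter> frac_below K t \<inter> {real n / real R..<real (Suc n) / real R}
     = frac_below K t \<inter> {?a..<?b}"
    using frac_below_cell[OF R t, of n] by blast
  have "measure lborel (frac_below R t \<inter> frac_below K t \<inter> {0..<real (Suc n) / real R})
    = measure lborel (frac_below R t \<inter> frac_below K t \<inter> {0..<real n / real R})
      + measure lborel (frac_below K t \<inter> {?a..<?b})"
    unfolding cell[symmetric] by (intro measure_Ico_split) (auto simp: divide_right_mono)
  moreover have "measure lborel (frac_below K t \<inter> {0..<?b})
      = measure lborel (frac_below K t \<inter> {0..<?a}) + measure lborel (frac_below K t \<inter> {?a..<?b})"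
    using ab by (intro measure_Ico_split) auto
  moreover have "measure lborel (frac_below K t \<inter> {0..<?b}) \<le> t * ?b + 1 / real K"
    using measure_frac_below_le[OF K t, of ?b] t by (simp add: abs_le_iff)
  moreover have "measure lborel (frac_below K t \<inter> {0..<?a}) \<ge> t * ?a - 1 / real K"
    using measure_frac_below_le[OF K t, of ?a] t by (simp add: abs_le_iff)
  moreover have "t * ?b - t * ?a = t\<^sup>2 / real R"
    using R by (simp add: field_simps power2_eq_square)
  ultimately have "measure lborel (frac_below R t \<inter> frac_below K t \<inter> {0..<real (Suc n) / real R})
    \<le> t\<^sup>2 * (real n / real R) + 2 * real n / real K + t\<^sup>2 / real R + 2 * (1 / real K)"
    using Suc by linarith
  also have "\<dots> = t\<^sup>2 * (real (Suc n) / real R) + 2 * real (Suc n) / real K"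
    by (simp add: add_divide_distrib distrib_left)
  finally show ?case .
qed simp

lemma lacunary_ratio:
  fixes R :: "nat \<Rightarrow> nat"
  assumes "\<And>i. 2 * R i \<le> R (Suc i)" and "\<And>i. R i > 0" and "i \<le> j"
  shows "real (R i) / real (R j) \<le> (1/2) ^ (j - i)"
proof -
  have "2 ^ k * R i \<le> R (i + k)" for k
  proof (induction k)
    case (Suc k)
    then show ?case using assms(1)[of "i + k"] by simp
  qed simp
  from this[of "j - i"] have "2 ^ (j - i) * R i \<le> R j" using assms(3) by simp
  then have "2 ^ (j - i) * real (R i) \<le> real (R j)"
    using of_nat_mono[where 'a = real] by fastforce
  then have "real (R i) / real (R j) \<le> 1 / 2 ^ (j - i)"
    using assms(2)[of j] by (simp add: divide_le_eq le_divide_eq mult.commute)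
  then show ?thesis by (simp add: power_one_over)
qed

text \<open>The interval [0, 1) consists of \<open>R i\<close> cells, so the errors of
  \<open>measure_frac_below_inter_le\<close> add up to 2 R i / R j, which lacunarity bounds by 2
  (1/2)^(j - i).\<close>

lemma AE_lacunary_ud:
  fixes R :: "nat \<Rightarrow> nat"
  assumes R: "\<And>i. 2 * R i \<le> R (Suc i)" and Rpos: "\<And>i. R i > 0"
  shows "AE x in lborel. x \<in> {0..<1} \<longrightarrow> ud_mod1 (\<lambda>j. frac (real (R j) * x))"
proof -
  define M where "M = restrict_space lborel {0..<1::real}"
  have M: "measure M A = measure lborel A" if "A \<subseteq> {0..<1}" for A
    using that unfolding M_def by (intro measure_restrict_space) auto
  have sp: "space M = {0..<1}" by (simp add: M_def)
  interpret finite_measure M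
    by (rule finite_measureI) (simp add: M_def emeasure_restrict_space)
  have "AE x in M. (\<lambda>n. real (card {i. i < n \<and> frac (real (R i) * x) \<in> {0..<t}}) / real n) \<longlonglongrightarrow> t"
    if t: "t \<in> \<rat> \<inter> {0..1}" for t
  proof -
    define A where "A = (\<lambda>i. frac_below (R i) t \<inter> {0..<1})"
    have t': "0 \<le> t" "t \<le> 1" using t by auto
    have A: "A i \<in> sets M" for i unfolding A_def M_def by (auto simp: sets_restrict_space_iff)
    have mean: "measure M (A i) = t" for i
      using measure_frac_below_grid[OF Rpos t', of i "R i"] Rpos[of i] by (subst M) (auto simp: A_def)
    have "measure M (A i \<inter> A j) - t\<^sup>2 \<le> 2 * (1/2) ^ (j - i)" if "i \<le> j" for i j
    proof -
      have "measure M (A i \<inter> A j) = measure lborel (frac_below (R i) t \<inter> frac_below (R j) t \<inter> {0..<1})"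
        by (subst M) (auto simp: A_def intro!: arg_cong[of _ _ "measure lborel"])
      also have "\<dots> \<le> t\<^sup>2 + 2 * real (R i) / real (R j)"
        using measure_frac_below_inter_le[OF Rpos Rpos t', of i j "R i"] Rpos[of i] by simp
      also have "2 * real (R i) / real (R j) \<le> 2 * (1/2) ^ (j - i)"
        using lacunary_ratio[where R = R, OF R Rpos that] by simp
      finally show ?thesis by simp
    qed
    then have "AE x in M. (\<lambda>n. real (card {i. i < n \<and> x \<in> A i}) / real n) \<longlonglongrightarrow> t"
      using M[of "{0..<1}"] by (intro AE_frequency_tendsto[where c = 2] A mean) (auto simp: sp)
    moreover have "AE x in M. x \<in> {0..<1}" by (rule AE_I2) (simp add: sp)
    ultimately show ?thesis
    proof eventually_elim
      case (elim x)
      then have "{i. i < n \<and> x \<in> A i} = {i. i < n \<and> frac (real (R i) * x) \<in> {0..<t}}" for n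
        by (auto simp: A_def frac_below_def)
      with elim(1) show ?case by simp
    qed
  qed
  then have "AE x in M. \<forall>t\<in>\<rat> \<inter> {0..1}.
      (\<lambda>n. real (card {i. i < n \<and> frac (real (R i) * x) \<in> {0..<t}}) / real n) \<longlonglongrightarrow> t"
    by (intro AE_ball_countable') (auto intro: countable_rat)
  then have "AE x in M. ud_mod1 (\<lambda>j. frac (real (R j) * x))"
    by eventually_elim (rule ud_mod1I_Rats, blast)
  then show ?thesis unfolding M_def by (subst (asm) AE_restrict_space_iff) auto
qed

text \<open>The multipliers are integers, so integer translations of x do not change the sequence;
  countably many translates of the exceptional set in [0, 1) cover everything.\<close>

lemma negligible_not_lacunary_ud:
  fixes R :: "nat \<Rightarrow> nat"
  assumes R: "\<And>i. 2 * R i \<le> R (Suc i)" and Rpos: "\<And>i. R i > 0"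
  shows "negligible {x. \<not> ud_mod1 (\<lambda>j. frac (real (R j) * x))}" (is "negligible ?B")
proof -
  define N where "N = {x \<in> {0..<1}. \<not> ud_mod1 (\<lambda>j. frac (real (R j) * x))}"
  obtain N' where N': "{x \<in> space lborel. \<not> (x \<in> {0..<1} \<longrightarrow> ud_mod1 (\<lambda>j. frac (real (R j) * x)))} \<subseteq> N'"
    "emeasure lborel N' = 0" "N' \<in> sets lborel"
    using AE_lacunary_ud[where R = R, OF assms] by (rule AE_E)
  have "N' \<in> null_sets lborel" using N' by (intro null_setsI)
  moreover have "N \<subseteq> N'" using N'(1) by (auto simp: N_def)
  ultimately have "negligible N"
    unfolding negligible_iff_null_sets null_sets_completion_iff2 by blast
  then have neg: "negligible (\<Union>k::int. (+) (real_of_int k) ` N)"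
    by (intro negligible_countable_Union) (auto intro: negligible_translation)
  have "?B \<subseteq> (\<Union>k::int. (+) (real_of_int k) ` N)"
  proof
    fix x assume x: "x \<in> ?B"
    have "frac (real (R j) * frac x) = frac (real (R j) * x)" for j
    proof -
      have "real (R j) * x = real_of_int (int (R j) * \<lfloor>x\<rfloor>) + real (R j) * frac x"
        by (simp add: frac_def algebra_simps)
      then show ?thesis by (simp only: frac_add_of_int_left)
    qed
    then have "frac x \<in> N" using x by (simp add: N_def frac_lt_1)
    then have "x \<in> (+) (real_of_int \<lfloor>x\<rfloor>) ` N"
      by (intro image_eqI[of _ _ "frac x"]) (auto simp: frac_def)
    then show "x \<in> (\<Union>k::int. (+) (real_of_int k) ` N)" by blast
  qed
  with neg show ?thesis by (rule negligible_subset)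
qed

lemma negligible_not_ud_even_progression:
  assumes q: "basic_sequence q"
  shows "negligible {x. \<not> ud_mod1 (\<lambda>n. cantor_T q (2 * n) x)}"
proof -
  have "2 * (\<Prod>k=1..2 * i. q k) \<le> (\<Prod>k=1..2 * Suc i. q k)" for i
    by (rule prod_less_le_double[OF q]) simp
  then show ?thesis
    unfolding cantor_T_def by (rule negligible_not_lacunary_ud) (rule basic_sequence_prod_pos[OF q])
qed

lemma exists_ud_mod1: "\<exists>z. ud_mod1 z \<and> range z \<subseteq> {0..<1}"
proof -
  have "negligible {x. \<not> ud_mod1 (\<lambda>j. frac (real (2 ^ j) * x))}"
    by (rule negligible_not_lacunary_ud) auto
  then have "{x. \<not> ud_mod1 (\<lambda>j. frac (real (2 ^ j) * x))} \<noteq> UNIV"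
    by (metis non_negligible_UNIV)
  then obtain x where "ud_mod1 (\<lambda>j. frac (real (2 ^ j) * x))" by auto
  then show ?thesis by (intro exI[of _ "\<lambda>j. frac (real (2 ^ j) * x)"]) (auto simp: frac_lt_1)
qed

section \<open>A uniformly distributed sequence without uniformly distributed progressions\<close>

text \<open>The index j encodes a triple whose last entry is free, so every pair (m, r) recurs for
  arbitrarily large j. If the coded modulus is not between 2 and j/2, it is replaced by 2, which is
  admissible from j = 4 on.\<close>

lemma exists_schedule:
  "\<exists>M \<rho> :: nat \<Rightarrow> nat. (\<forall>j\<ge>4. 2 \<le> M j \<and> 2 * M j \<le> j \<and> \<rho> j < M j) \<and>
     (\<forall>m\<ge>2. \<forall>r<m. \<forall>J. \<exists>j\<ge>J. M j = m \<and> \<rho> j = r)"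
proof -
  define a where "a = (\<lambda>j. fst (prod_decode (fst (prod_decode j))))"
  define M where "M = (\<lambda>j. if 2 \<le> a j \<and> 2 * a j \<le> j then a j else 2)"
  define \<rho> where "\<rho> = (\<lambda>j. snd (prod_decode (fst (prod_decode j))) mod M j)"
  have 1: "2 \<le> M j" "2 * M j \<le> j" if "j \<ge> 4" for j
    using that by (auto simp: M_def)
  then have 2: "\<rho> j < M j" if "j \<ge> 4" for j
    using that by (fastforce simp: \<rho>_def)
  have 3: "\<exists>j\<ge>J. M j = m \<and> \<rho> j = r" if "m \<ge> 2" "r < m" for m r J
  proof (intro exI conjI)
    \<comment> \<open>A code is at least its second component; J + 2 * m makes the index large
      enough both for J and for the modulus m.\<close>
    let ?j = "prod_encode (prod_encode (m, r), J + 2 * m)"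
    have ge: "J + 2 * m \<le> ?j" by (rule le_prod_encode_2)
    then show "J \<le> ?j" by simp
    show "M ?j = m" using that ge by (simp add: M_def a_def)
    then show "\<rho> ?j = r" using that by (simp add: \<rho>_def)
  qed
  from 1 2 3 show ?thesis by (intro exI[of _ M] exI[of _ \<rho>]) simp
qed

text \<open>Class r is constantly False, the cyclically next class is its counterweight, and the
  remaining classes alternate between consecutive stretches of length m. Hence the values balance
  over a period 2 m.\<close>

definition pattern :: "nat \<Rightarrow> nat \<Rightarrow> nat \<Rightarrow> bool" where
  "pattern m r n = (if n mod m = r then False else if n mod m = Suc r mod m then True else odd (n div m))"

definition bit_sign :: "bool \<Rightarrow> real" where
  "bit_sign b = (if b then 1 else - 1)"

lemma pattern_periodic:
  assumes "m \<ge> 1" shows "pattern m r (n + 2 * m) = pattern m r n"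
  using assms by (simp add: pattern_def)

lemma pattern_sum_period:
  assumes "m \<ge> 2" "r < m"
  shows "(\<Sum>i<2 * m. bit_sign (pattern m r i)) = 0"
proof -
  let ?r = "Suc r mod m"
  have r: "?r < m" "?r \<noteq> r" using assms by (auto simp: mod_Suc)
  have "(\<Sum>i<2 * m. bit_sign (pattern m r i)) = (\<Sum>i<m. bit_sign (pattern m r i)) + (\<Sum>i<m. bit_sign (pattern m r (m + i)))"
  proof -
    have "(\<Sum>i<m + k. f i) = (\<Sum>i<m. f i) + (\<Sum>i<k. f (m + i))" for k and f :: "nat \<Rightarrow> real"
      by (induction k) (auto simp: add.assoc)
    then show ?thesis by (simp only: mult_2)
  qed
  also have "\<dots> = (\<Sum>i<m. (if i = r then -2 else 0) + (if i = ?r then 2 else 0))"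
    unfolding sum.distrib[symmetric]
    by (rule sum.cong) (use assms r in \<open>auto simp: pattern_def bit_sign_def div_add_self1\<close>)
  also have "\<dots> = 0" using assms r by (simp add: sum.distrib)
  finally show ?thesis .
qed

lemma periodic_sum_bounded:
  fixes f :: "nat \<Rightarrow> real"
  assumes p: "p > 0" and per: "\<And>n. f (n + p) = f n" and zero: "(\<Sum>i<p. f i) = 0"
    and bound: "\<And>n. \<bar>f n\<bar> \<le> 1"
  shows "\<bar>\<Sum>i<n. f i\<bar> \<le> real p" and "p dvd n \<Longrightarrow> (\<Sum>i<n. f i) = 0"
proof -
  have shift: "(\<Sum>i<n + p. f i) = (\<Sum>i<n. f i)" for n
    by (induction n) (auto simp: zero per)
  have mult: "(\<Sum>i<l + k * p. f i) = (\<Sum>i<l. f i)" for k l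
  proof (induction k)
    case (Suc k)
    then show ?case using shift[of "l + k * p"] by (simp add: algebra_simps)
  qed simp
  have eq: "(\<Sum>i<n. f i) = (\<Sum>i<n mod p. f i)" for n
    using mult[of "n mod p" "n div p"] by simp
  have "\<bar>\<Sum>i<n mod p. f i\<bar> \<le> (\<Sum>i<n mod p. 1)"
    using bound by (intro order_trans[OF sum_abs] sum_mono) auto
  also have "\<dots> \<le> real p" using p by (simp add: less_imp_le)
  finally show "\<bar>\<Sum>i<n. f i\<bar> \<le> real p" using eq by simp
  show "(\<Sum>i<n. f i) = 0" if "p dvd n" using that eq[of n] by simp
qed

definition fact_block :: "nat \<Rightarrow> nat" where
  "fact_block n = (LEAST j. n < fact (Suc j))"

lemma fact_block_less: "n < fact (Suc (fact_block n))"
proof -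
  have "n < fact (Suc n)" using fact_ge_self[of "Suc n"] by linarith
  then show ?thesis unfolding fact_block_def by (rule LeastI)
qed

lemma fact_block_le:
  assumes "n > 0" shows "fact (fact_block n) \<le> n"
proof (cases "fact_block n")
  case (Suc i)
  then have "\<not> n < fact (Suc i)" unfolding fact_block_def by (intro not_less_Least) simp
  then show ?thesis by (simp add: Suc)
qed (use assms in simp)

lemma fact_block_eq:
  assumes "fact j \<le> n" "n < fact (Suc j)" shows "fact_block n = j"
  unfolding fact_block_def
proof (rule Least_equality)
  fix i assume i: "n < fact (Suc i)"
  show "j \<le> i"
  proof (rule ccontr)
    assume "\<not> j \<le> i"
    then have "fact (Suc i) \<le> (fact j :: nat)" by (intro fact_mono) auto
    then show False using i assms(1) by linarith
  qed
qed (rule assms)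

text \<open>On the block \<open>[j!, (j+1)!)\<close> the bits are constant on one residue class modulo \<open>m \<le> j/2\<close>. Both
  ends are multiples of the period \<open>2m\<close>, so that the signs cancel exactly over the block, while the
  block makes up almost all of \<open>[0, (j+1)!)\<close>.\<close>

lemma exists_balanced_bits:
  "\<exists>b :: nat \<Rightarrow> bool. (\<lambda>n. real (card {i. i < n \<and> b i}) / real n) \<longlonglongrightarrow> 1/2 \<and>
     (\<forall>m\<ge>2. \<forall>r<m. \<not> (\<lambda>n. real (card {i. i < n \<and> \<not> b (m * i + r)}) / real n) \<longlonglongrightarrow> 1/2)"
proof -
  obtain M \<rho> :: "nat \<Rightarrow> nat" where
    *: "\<forall>j\<ge>4. 2 \<le> M j \<and> 2 * M j \<le> j \<and> \<rho> j < M j" and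
    **: "\<forall>m\<ge>2. \<forall>r<m. \<forall>J. \<exists>j\<ge>J. M j = m \<and> \<rho> j = r"
    using exists_schedule by (elim exE conjE)
  have M: "2 \<le> M j" "2 * M j \<le> j" "\<rho> j < M j" if "j \<ge> 4" for j using * that by auto
  have sched: "\<exists>j\<ge>J. M j = m \<and> \<rho> j = r" if "m \<ge> 2" "r < m" for m r J using ** that by simp
  define b where "b = (\<lambda>n. pattern (M (fact_block n)) (\<rho> (fact_block n)) n)"
  define S where "S = (\<lambda>n. \<Sum>i<n. bit_sign (b i))"
  have block: "b n = pattern (M j) (\<rho> j) n" if "fact j \<le> n" "n < fact (Suc j)" for n j
    using fact_block_eq[OF that] by (simp add: b_def)
  have sign1: "\<bar>bit_sign c\<bar> \<le> 1" for c by (simp add: bit_sign_def)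
  \<comment> \<open>The sum as if pattern j were in force from time 0. It vanishes at j!, a multiple
    of the period, and therefore equals the increment of S since the start of block j.\<close>
  define F where "F = (\<lambda>j n. \<Sum>i<n. bit_sign (pattern (M j) (\<rho> j) i))"
  have F: "\<bar>F j n\<bar> \<le> real j" "2 * M j dvd n \<Longrightarrow> F j n = 0" if "j \<ge> 4" for j n
  proof -
    have m: "2 * M j > 0" "M j \<ge> 1" using M(1)[OF that] by auto
    note * = periodic_sum_bounded[of "2 * M j" "\<lambda>i. bit_sign (pattern (M j) (\<rho> j) i)",
      OF m(1) arg_cong[of _ _ bit_sign, OF pattern_periodic[OF m(2)]] pattern_sum_period[OF M(1,3)[OF that]] sign1]
    have "\<bar>F j n\<bar> \<le> real (2 * M j)" unfolding F_def by (rule *(1))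
    also have "\<dots> \<le> real j" using M(2)[OF that] by linarith
    finally show "\<bar>F j n\<bar> \<le> real j" .
    show "2 * M j dvd n \<Longrightarrow> F j n = 0" unfolding F_def by (rule *(2))
  qed
  have SF: "S n = S (fact j) + F j n" if j: "j \<ge> 4" and n: "fact j \<le> n" "n \<le> fact (Suc j)" for j n
  proof -
    have "S n = S (fact j) + (\<Sum>i=fact j..<n. bit_sign (b i))"
      unfolding S_def using n by (metis sum.atLeastLessThan_concat lessThan_atLeast0 le0)
    also have "(\<Sum>i=fact j..<n. bit_sign (b i)) = (\<Sum>i=fact j..<n. bit_sign (pattern (M j) (\<rho> j) i))"
      using n by (intro sum.cong arg_cong[of _ _ bit_sign] block) auto
    also have "\<dots> = F j n - F j (fact j)"
      unfolding F_def using n(1) by (metis add_diff_cancel_left' sum.atLeastLessThan_concat lessThan_atLeast0 le0)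
    also have "F j (fact j) = 0" using M(1,2)[OF j] by (intro F(2)[OF j] dvd_fact) auto
    finally show ?thesis by simp
  qed
  \<comment> \<open>Blocks from j = 4 on have total 0, so S stays constant along the factorials; 24
    = 4! bounds the contribution of the uncontrolled start.\<close>
  have Sfact: "\<bar>S (fact j)\<bar> \<le> 24" if "j \<ge> 4" for j
    using that
  proof (induction j rule: dec_induct)
    case base
    have "\<bar>S (fact 4)\<bar> \<le> (\<Sum>i<(fact 4 :: nat). 1)"
      unfolding S_def by (intro order_trans[OF sum_abs] sum_mono sign1)
    also have "\<dots> = 24" by (simp add: fact_numeral)
    finally show ?case .
  next
    case (step j)
    have "2 * M j dvd fact (Suc j)" using M(1,2)[OF step(1)] by (intro dvd_fact) auto
    then have "S (fact (Suc j)) = S (fact j)"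
      using SF[OF step(1), of "fact (Suc j)"] F(2)[OF step(1)] fact_mono_nat[of j "Suc j"] by simp
    then show ?case using step by simp
  qed
  have Sbound: "\<bar>S n\<bar> \<le> 25 + sqrt (real n)" if n: "n \<ge> 24" for n
  proof -
    let ?j = "fact_block n"
    have j4: "?j \<ge> 4"
    proof (rule ccontr)
      assume "\<not> ?j \<ge> 4"
      then have "fact (Suc ?j) \<le> (fact 4 :: nat)" by (intro fact_mono) auto
      moreover have "(fact 4 :: nat) = 24" by (simp add: fact_numeral)
      ultimately show False using fact_block_less[of n] n by linarith
    qed
    have le: "fact ?j \<le> n" using n by (intro fact_block_le) auto
    then have "\<bar>S n\<bar> \<le> \<bar>S (fact ?j)\<bar> + \<bar>F ?j n\<bar>"
      using SF[OF j4 le] fact_block_less[of n] by simp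
    also have "\<dots> \<le> 24 + real ?j" using Sfact[OF j4] F(1)[OF j4] by (intro add_mono)
    \<comment> \<open>The deviation inside a block is at most j, and j is small against n because (j
      - 1)^2 \<le> j! \<le> n.\<close>
    also have "real ?j \<le> 1 + sqrt (real n)"
    proof -
      obtain i where i: "?j = Suc i" using j4 by (cases ?j) auto
      have "i * i \<le> Suc i * fact i" by (intro mult_mono fact_ge_self) auto
      also have "\<dots> \<le> n" using le i by simp
      finally have "(real i)\<^sup>2 \<le> real n" by (metis of_nat_le_iff of_nat_mult power2_eq_square)
      then have "real i \<le> sqrt (real n)" by (rule real_le_rsqrt)
      then show ?thesis using i by simp
    qed
    finally show ?thesis by simp
  qed
  have Slim: "(\<lambda>n. S n / real n) \<longlonglongrightarrow> 0"
  proof (rule Lim_null_comparison)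
    show "\<forall>\<^sub>F n in sequentially. norm (S n / real n) \<le> 25 / real n + 1 / sqrt (real n)"
    proof (intro eventually_mono[OF eventually_ge_at_top[of 24]])
      fix n :: nat assume n: "24 \<le> n"
      have "\<bar>S n\<bar> / real n \<le> (25 + sqrt (real n)) / real n" using Sbound[OF n] by (intro divide_right_mono) auto
      also have "\<dots> = 25 / real n + 1 / sqrt (real n)"
        using n by (simp add: add_divide_distrib sqrt_divide_self_eq inverse_eq_divide)
      finally show "norm (S n / real n) \<le> 25 / real n + 1 / sqrt (real n)" by simp
    qed
    have "(\<lambda>n. 1 / sqrt (real n)) \<longlonglongrightarrow> 0"
      by (intro tendsto_divide_0[OF tendsto_const] filterlim_at_top_imp_at_infinity
          filterlim_compose[OF sqrt_at_top] filterlim_real_sequentially)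
    then show "(\<lambda>n. 25 / real n + 1 / sqrt (real n)) \<longlonglongrightarrow> 0"
      using tendsto_add[OF lim_const_over_n[of "25::real"]] by fastforce
  qed
  have "(\<lambda>n. (1 + S n / real n) / 2) \<longlonglongrightarrow> (1 + 0) / 2"
    by (intro tendsto_intros Slim) auto
  moreover have "\<forall>\<^sub>F n in sequentially. (1 + S n / real n) / 2 = real (card {i. i < n \<and> b i}) / real n"
  proof (intro eventually_mono[OF eventually_gt_at_top[of 0]])
    fix n :: nat assume n: "n > 0"
    have "S n = 2 * real (card {i. i < n \<and> b i}) - real n" for n
    proof -
      have "S n = (\<Sum>i<n. 2 * (if b i then 1 else 0) - 1)"
        unfolding S_def by (intro sum.cong) (auto simp: bit_sign_def)
      also have "\<dots> = 2 * (\<Sum>i<n. if b i then 1 else 0) - real n"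
        by (simp add: sum_subtractf flip: sum_distrib_left)
      also have "(\<Sum>i<n. if b i then 1 else 0) = real (card {i. i < n \<and> b i})"
        by (simp add: sum.If_cases Int_def conj_commute)
      finally show ?thesis .
    qed
    then show "(1 + S n / real n) / 2 = real (card {i. i < n \<and> b i}) / real n"
      using n by (simp add: field_simps)
  qed
  ultimately have half: "(\<lambda>n. real (card {i. i < n \<and> b i}) / real n) \<longlonglongrightarrow> 1/2"
    using Lim_transform_eventually by fastforce
  have "\<not> (\<lambda>n. real (card {i. i < n \<and> \<not> b (m * i + r)}) / real n) \<longlonglongrightarrow> 1/2"
    if m: "m \<ge> 2" "r < m" for m r
  proof
    assume "(\<lambda>n. real (card {i. i < n \<and> \<not> b (m * i + r)}) / real n) \<longlonglongrightarrow> 1/2"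
    then have "\<forall>\<^sub>F n in sequentially. real (card {i. i < n \<and> \<not> b (m * i + r)}) / real n < 3/4"
      by (rule order_tendstoD) simp
    then obtain n0 where n0: "\<And>n. n \<ge> n0 \<Longrightarrow> real (card {i. i < n \<and> \<not> b (m * i + r)}) / real n < 3/4"
      by (auto simp: eventually_sequentially)
    obtain j where j: "j \<ge> n0 + 4" "M j = m" "\<rho> j = r" using sched[OF m] by blast
    \<comment> \<open>Along the progression, block j is the index range [d, n) with n = (j + 1) d,
      on which all bits are False. At most n / (j + 1) of the n bits can be True, and j \<ge>
      4.\<close>
    have "m dvd fact j" using M(2)[of j] j m by (intro dvd_fact) auto
    then obtain d where d: "fact j = m * d" by blast
    then have "d \<noteq> 0" by (metis fact_nonzero mult_0_right)
    define n where "n = Suc j * d"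
    have nd: "fact (Suc j) = m * n" by (simp add: d n_def algebra_simps)
    have "\<not> b (m * i + r)" if "i \<in> {d..<n}" for i
    proof -
      have "m * d \<le> m * i + r" using that by (intro trans_le_add1 mult_le_mono2) simp
      moreover have "m * Suc i \<le> m * n" using that by (intro mult_le_mono2) simp
      then have "m * i + r < m * n" using m(2) by simp
      ultimately have "b (m * i + r) = pattern m r (m * i + r)"
        using block[of j "m * i + r"] j(2,3) unfolding d nd by simp
      then show ?thesis using m by (simp add: pattern_def)
    qed
    then have "card {d..<n} \<le> card {i. i < n \<and> \<not> b (m * i + r)}" by (intro card_mono) auto
    then have ge: "real n - real d \<le> real (card {i. i < n \<and> \<not> b (m * i + r)})" by simp
    have "j * 1 \<le> Suc j * d" using \<open>d \<noteq> 0\<close> by (intro mult_le_mono) auto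
    then have "j \<le> n" by (simp add: n_def)
    then have "real (card {i. i < n \<and> \<not> b (m * i + r)}) / real n < 3/4" using j by (intro n0) simp
    moreover have "n > 0" using \<open>d \<noteq> 0\<close> by (simp add: n_def)
    ultimately have "real (card {i. i < n \<and> \<not> b (m * i + r)}) < 3/4 * real n" by (simp add: divide_less_eq)
    with ge have "real n < 4 * real d" by linarith
    moreover have "4 * d \<le> n" using j unfolding n_def by (intro mult_right_mono) auto
    then have "4 * real d \<le> real n" by linarith
    ultimately show False by linarith
  qed
  with half show ?thesis by blast
qed

section \<open>Distributing a uniformly distributed sequence according to the bits\<close>

lemma card_less_Suc_filter:
  "card {i. i < Suc n \<and> P i} = (if P n then Suc (card {i. i < n \<and> P i}) else card {i. i < n \<and> P i})"
proof -
  have "{i. i < Suc n \<and> P i} = (if P n then insert n {i. i < n \<and> P i} else {i. i < n \<and> P i})"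
    by (auto simp: less_Suc_eq)
  then show ?thesis by simp
qed

text \<open>The inner cardinality is the rank of i among the indices satisfying b. Ranks run through
  0, 1, 2, ... without gaps, so counting by index and counting by rank agree.\<close>

lemma card_filter_reindex:
  fixes n :: nat shows
  "card {i. i < n \<and> b i \<and> P (card {k. k < i \<and> b k})} = card {k. k < card {i. i < n \<and> b i} \<and> P k}"
  by (induction n) (simp_all add: card_less_Suc_filter)

text \<open>By time n about n/2 terms of z have been consumed, and a proportion tending to u of them
  lies in [0, u).\<close>

lemma frequency_along_filter:
  fixes z :: "nat \<Rightarrow> real"
  assumes ud: "ud_mod1 z" and u: "u \<in> {0..1}"
    and half: "(\<lambda>n. real (card {i. i < n \<and> b i}) / real n) \<longlonglongrightarrow> 1/2"
  shows "(\<lambda>n. real (card {i. i < n \<and> b i \<and> z (card {k. k < i \<and> b k}) \<in> {0..<u}}) / real n) \<longlonglongrightarrow> u / 2"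
proof -
  define c where "c = (\<lambda>n. card {i. i < n \<and> b i})"
  have "filterlim (\<lambda>n. real (c n) / real n * real n) at_top sequentially"
    using half unfolding c_def
    by (intro filterlim_tendsto_pos_mult_at_top[OF _ _ filterlim_real_sequentially]) auto
  moreover have "\<forall>\<^sub>F n in sequentially. real (c n) / real n * real n = real (c n)"
    by (intro eventually_mono[OF eventually_gt_at_top[of 0]]) auto
  ultimately have "filterlim (\<lambda>n. real (c n)) at_top sequentially"
    using filterlim_cong by fastforce
  then have "filterlim c at_top sequentially"
    by (simp add: filterlim_sequentially_iff_filterlim_real)
  then have "(\<lambda>n. real (card {k. k < c n \<and> z k \<in> {0..<u}}) / real (c n)) \<longlonglongrightarrow> u"
    using ud u unfolding ud_mod1_def by (auto intro: filterlim_compose)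
  then have "(\<lambda>n. real (card {k. k < c n \<and> z k \<in> {0..<u}}) / real (c n) * (real (c n) / real n)) \<longlonglongrightarrow> u * (1/2)"
    using half unfolding c_def by (intro tendsto_mult)
  moreover have "real (card {k. k < c n \<and> z k \<in> {0..<u}}) / real (c n) * (real (c n) / real n)
     = real (card {i. i < n \<and> b i \<and> z (card {k. k < i \<and> b k}) \<in> {0..<u}}) / real n" for n
    using card_filter_reindex[of n b "\<lambda>k. z k \<in> {0..<u}"]
    unfolding fun_cong[OF c_def, symmetric]
    by (cases "c n = 0") simp_all
  ultimately show ?thesis by (simp only: mult_1_right times_divide_eq_right)
qed

text \<open>The bit chooses the half of [0, 1), and each half runs through its own rescaled copy of
  z. Along a progression the frequency of [0, 1/2) is that of the bit False, which does not tend to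
  1/2.\<close>

lemma exists_ud_AP_abnormal:
  "\<exists>y. range y \<subseteq> {0..<1} \<and> ud_mod1 y \<and> (\<forall>m\<ge>2. \<forall>r<m. \<not> ud_mod1 (\<lambda>n. y (m * n + r)))"
proof -
  obtain z where z: "ud_mod1 z" "range z \<subseteq> {0..<1}" using exists_ud_mod1 by blast
  have z01: "0 \<le> z i" "z i < 1" for i using subsetD[OF z(2) rangeI] by auto
  obtain b :: "nat \<Rightarrow> bool" where
    half: "(\<lambda>n. real (card {i. i < n \<and> b i}) / real n) \<longlonglongrightarrow> 1/2" and
    bad: "\<And>m r. m \<ge> 2 \<Longrightarrow> r < m \<Longrightarrow> \<not> (\<lambda>n. real (card {i. i < n \<and> \<not> b (m * i + r)}) / real n) \<longlonglongrightarrow> 1/2"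
    using exists_balanced_bits by blast
  have half': "(\<lambda>n. real (card {i. i < n \<and> \<not> b i}) / real n) \<longlonglongrightarrow> 1/2"
  proof -
    have "(\<lambda>n. 1 - real (card {i. i < n \<and> b i}) / real n) \<longlonglongrightarrow> 1 - 1/2"
      by (intro tendsto_diff half tendsto_const)
    moreover have "\<forall>\<^sub>F n in sequentially. 1 - real (card {i. i < n \<and> b i}) / real n
        = real (card {i. i < n \<and> \<not> b i}) / real n"
    proof (intro eventually_mono[OF eventually_gt_at_top[of 0]])
      fix n :: nat assume "n > 0"
      have "card {i. i < n \<and> b i} + card {i. i < n \<and> \<not> b i} = n"
        by (induction n) (auto simp: card_less_Suc_filter)
      then have "real (card {i. i < n \<and> b i}) + real (card {i. i < n \<and> \<not> b i}) = real n"
        by (metis of_nat_add)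
      then show "1 - real (card {i. i < n \<and> b i}) / real n = real (card {i. i < n \<and> \<not> b i}) / real n"
        using \<open>n > 0\<close> by (simp add: field_simps)
    qed
    ultimately show ?thesis using Lim_transform_eventually by fastforce
  qed
  define y where "y = (\<lambda>n. if b n then (1 + z (card {k. k < n \<and> b k})) / 2 else z (card {k. k < n \<and> \<not> b k}) / 2)"
  have y0: "0 \<le> y n" for n
    using z01(1)[of "card {k. k < n \<and> b k}"] z01(1)[of "card {k. k < n \<and> \<not> b k}"] by (auto simp: y_def)
  have y1: "y n < 1" for n
    using z01(2)[of "card {k. k < n \<and> b k}"] z01(2)[of "card {k. k < n \<and> \<not> b k}"] by (auto simp: y_def)
  have yhalf: "y n < 1/2 \<longleftrightarrow> \<not> b n" for n
    using z01(1)[of "card {k. k < n \<and> b k}"] z01(2)[of "card {k. k < n \<and> \<not> b k}"] by (auto simp: y_def)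
  have "ud_mod1 y"
    unfolding ud_mod1_def
  proof
    fix t :: real assume t: "t \<in> {0..1}"
    \<comment> \<open>The threshold t in the coordinates of the lower and of the upper half: for t
      \<le> 1/2 the upper half is not reached, for t \<ge> 1/2 the lower half is exhausted.\<close>
    let ?u = "min 1 (2 * t)" and ?v = "max 0 (2 * t - 1)"
    let ?A = "\<lambda>n. {i. i < n \<and> \<not> b i \<and> z (card {k. k < i \<and> \<not> b k}) \<in> {0..<?u}}"
    let ?B = "\<lambda>n. {i. i < n \<and> b i \<and> z (card {k. k < i \<and> b k}) \<in> {0..<?v}}"
    have "(\<lambda>n. real (card (?A n)) / real n + real (card (?B n)) / real n) \<longlonglongrightarrow> ?u / 2 + ?v / 2"
      using t by (intro tendsto_add frequency_along_filter z half half') auto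
    moreover have "?u / 2 + ?v / 2 = t" by (auto simp: min_def max_def diff_divide_distrib)
    moreover have "card {i. i < n \<and> y i \<in> {0..<t}} = card (?A n) + card (?B n)" for n
    proof -
      have "y i \<in> {0..<t} \<longleftrightarrow> (\<not> b i \<and> z (card {k. k < i \<and> \<not> b k}) \<in> {0..<?u}) \<or>
          (b i \<and> z (card {k. k < i \<and> b k}) \<in> {0..<?v})" for i
        using z01[of "card {k. k < i \<and> b k}"] z01[of "card {k. k < i \<and> \<not> b k}"]
        by (cases "b i") (auto simp: y_def)
      then have "{i. i < n \<and> y i \<in> {0..<t}} = ?A n \<union> ?B n" by blast
      then show ?thesis by (simp only:) (rule card_Un_disjoint, auto)
    qed
    ultimately show "(\<lambda>n. real (card {i. i < n \<and> y i \<in> {0..<t}}) / real n) \<longlonglongrightarrow> t"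
      by (simp add: add_divide_distrib)
  qed
  moreover have "\<not> ud_mod1 (\<lambda>n. y (m * n + r))" if "m \<ge> 2" "r < m" for m r
  proof
    assume "ud_mod1 (\<lambda>n. y (m * n + r))"
    then have "(\<lambda>n. real (card {i. i < n \<and> y (m * i + r) \<in> {0..<1/2}}) / real n) \<longlonglongrightarrow> 1/2"
      unfolding ud_mod1_def by (rule bspec) simp
    moreover have "y (m * i + r) \<in> {0..<1/2} \<longleftrightarrow> \<not> b (m * i + r)" for i
      using y0 yhalf by simp
    ultimately show False using bad[OF that] by simp
  qed
  ultimately show ?thesis using y0 y1 by (intro exI[of _ y]) auto
qed

section \<open>Hausdorff measures on the line\<close>

lemma harmonic_bracket:
  fixes \<eta> y :: real
  assumes "\<eta> > 0" "y \<ge> 0"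
  shows "\<exists>n. \<eta> * harm n \<le> y \<and> y \<le> \<eta> * harm (Suc n)"
proof -
  have "filterlim (\<lambda>n. \<eta> * harm n) at_top sequentially"
    using assms(1) harm_at_top by (intro filterlim_tendsto_pos_mult_at_top[OF tendsto_const]) auto
  then have "\<forall>\<^sub>F n in sequentially. y < \<eta> * harm n" by (simp add: filterlim_at_top_dense)
  then obtain m where m: "y < \<eta> * harm m" by (auto simp: eventually_sequentially)
  define n where "n = (LEAST n. y < \<eta> * harm n)"
  have n: "y < \<eta> * harm n" unfolding n_def using m by (rule LeastI)
  then obtain k where k: "n = Suc k" using assms by (cases n) (auto simp: harm_def)
  then have "\<not> y < \<eta> * harm k" unfolding n_def by (intro not_less_Least) simp
  then show ?thesis using n k by (intro exI[of _ k]) auto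
qed

text \<open>The line is covered by consecutive intervals of lengths \<open>\<eta>, \<eta>/2, \<eta>/3, \<dots>\<close> in both directions; the
  \<open>s\<close>-th powers of these lengths are summable for \<open>s > 1\<close>.\<close>

lemma hausdorff_measure_real_eq_0:
  fixes S :: "real set"
  assumes s: "s > 1"
  shows "hausdorff_measure s S = 0"
proof -
  define Z where "Z = (\<Sum>i. real (Suc i) powr (- s))"
  have summ: "summable (\<lambda>i. real (Suc i) powr (- s))"
    using s summable_real_powr_iff[of "- s"] by (subst summable_Suc_iff) simp
  have bound: "hausdorff_premeasure s \<delta> S \<le> ennreal ((2 * \<eta>) powr s * Z)"
    if \<eta>: "0 < \<eta>" "\<eta> \<le> \<delta>" for \<eta> \<delta>
  proof -
    define I where "I = (\<lambda>n. {\<eta> * harm n..\<eta> * harm (Suc n)})"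
    \<comment> \<open>The two directions are interleaved, which costs a factor 2: the set with index
      i has diameter \<eta> / (i div 2 + 1) \<le> 2 \<eta> / (i + 1).\<close>
    define U where "U = (\<lambda>i. if even i then I (i div 2) else uminus ` I (i div 2))"
    have len: "\<eta> * harm (Suc n) = \<eta> * harm n + \<eta> / real (Suc n)" for n
      by (simp add: harm_Suc divide_inverse distrib_left)
    have I: "I n = {\<eta> * harm n..\<eta> * harm n + \<eta> / real (Suc n)}" for n by (simp add: I_def len)
    have diamI: "diameter (I n) = \<eta> / real (Suc n)" for n
      unfolding I using \<eta> by (subst diameter_closed_interval) (simp_all add: not_less)
    have diamU: "diameter (U i) = \<eta> / real (Suc (i div 2))" for i
    proof (cases "even i")
      case False
      have "uminus ` I (i div 2) = {- (\<eta> * harm (i div 2) + \<eta> / real (Suc (i div 2)))..- (\<eta> * harm (i div 2))}"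
        unfolding I by (simp only: image_uminus_atLeastAtMost)
      then show ?thesis using False \<eta> by (simp add: U_def not_less)
    qed (simp add: U_def diamI del: of_nat_Suc)
    have bdd: "bounded (U i)" for i
      unfolding U_def I by (auto simp: bounded_uminus image_uminus_atLeastAtMost)
    have ne: "U i \<noteq> {}" for i using \<eta> by (auto simp: U_def I)
    have cover: "S \<subseteq> (\<Union>i. U i)"
    proof
      fix x :: real
      obtain n where n: "\<bar>x\<bar> \<in> I n"
        using harmonic_bracket[OF \<eta>(1), of "\<bar>x\<bar>"] by (auto simp: I_def)
      have "x \<in> U (if x \<ge> 0 then 2 * n else Suc (2 * n))"
      proof (cases "x \<ge> 0")
        case False
        then have "x = - \<bar>x\<bar>" by simp
        then have "x \<in> uminus ` I n" using n by (rule image_eqI)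
        then show ?thesis using False by (simp add: U_def)
      qed (use n in \<open>simp add: U_def\<close>)
      then show "x \<in> (\<Union>i. U i)" by blast
    qed
    have small: "diameter (U i) \<le> \<delta>" for i
    proof -
      have "\<eta> / real (Suc (i div 2)) \<le> \<eta>" using \<eta> by (simp add: divide_le_eq del: of_nat_Suc) 
      then show ?thesis using diamU \<eta> by simp
    qed
    have w: "diameter_weight s (U i) \<le> ennreal ((2 * \<eta>) powr s * real (Suc i) powr (- s))" for i
    proof -
      have "\<eta> / real (Suc (i div 2)) \<le> 2 * \<eta> / real (Suc i)"
      proof -
        have "Suc i \<le> 2 * Suc (i div 2)" by presburger
        then have "real (Suc i) \<le> 2 * real (Suc (i div 2))" by linarith
        then have "\<eta> * real (Suc i) \<le> \<eta> * (2 * real (Suc (i div 2)))"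
          using \<eta> by (intro mult_left_mono) auto
        then show ?thesis by (simp add: divide_le_eq le_divide_eq mult.commute mult.left_commute del: of_nat_Suc)
      qed
      then have "diameter (U i) powr s \<le> (2 * \<eta> / real (Suc i)) powr s"
        using \<eta> s unfolding diamU by (intro powr_mono2) auto
      also have "\<dots> = (2 * \<eta>) powr s * real (Suc i) powr (- s)"
        using \<eta> by (simp add: powr_divide powr_minus_divide del: of_nat_Suc)
      finally show ?thesis using ne s by (simp add: diameter_weight_def ennreal_leI del: of_nat_Suc)
    qed
    have "hausdorff_premeasure s \<delta> S \<le> (\<Sum>i. diameter_weight s (U i))"
      unfolding hausdorff_premeasure_def using cover bdd small by (intro INF_lower) auto
    also have "\<dots> \<le> (\<Sum>i. ennreal ((2 * \<eta>) powr s * real (Suc i) powr (- s)))"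
      by (intro suminf_le w summableI)
    also have "\<dots> = ennreal (\<Sum>i. (2 * \<eta>) powr s * real (Suc i) powr (- s))"
      using summ by (intro suminf_ennreal2 summable_mult) auto
    also have "(\<Sum>i. (2 * \<eta>) powr s * real (Suc i) powr (- s)) = (2 * \<eta>) powr s * Z"
      unfolding Z_def by (rule suminf_mult[OF summ])
    finally show ?thesis .
  qed
  \<comment> \<open>Every \<eta> \<le> \<delta> gives a cover admissible at scale \<delta>, so
    \<eta> can tend to 0 with \<delta> fixed.\<close>
  have "hausdorff_premeasure s \<delta> S \<le> 0" if \<delta>: "\<delta> > 0" for \<delta>
  proof (rule LIMSEQ_le_const)
    have "(\<lambda>n. 2 * \<delta> * (1 / real (Suc n))) \<longlonglongrightarrow> 2 * \<delta> * 0"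
      using LIMSEQ_inverse_real_of_nat by (intro tendsto_mult tendsto_const) (simp add: inverse_eq_divide)
    then have "(\<lambda>n. (2 * (\<delta> / real (Suc n))) powr s) \<longlonglongrightarrow> 0 powr s"
      using s \<delta> by (intro tendsto_powr') (auto intro!: always_eventually)
    then have "(\<lambda>n. (2 * (\<delta> / real (Suc n))) powr s * Z) \<longlonglongrightarrow> 0 powr s * Z"
      by (intro tendsto_mult tendsto_const)
    then show "(\<lambda>n. ennreal ((2 * (\<delta> / real (Suc n))) powr s * Z)) \<longlonglongrightarrow> 0"
      using s by (auto dest: tendsto_ennrealI)
    show "\<exists>N. \<forall>n\<ge>N. hausdorff_premeasure s \<delta> S \<le> ennreal ((2 * (\<delta> / real (Suc n))) powr s * Z)"
      using \<delta> by (intro exI allI impI bound) (auto simp: divide_le_eq)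
  qed
  then show ?thesis unfolding hausdorff_measure_def by (intro antisym SUP_least) auto
qed

text \<open>The inverse of \<phi> is s-Hoelder, so a cover of S pulls back to a cover of [0, 1) by
  sets of diameter at most C times their weights. Subadditivity of length gives total weight at
  least 1 / C, already at scale 1.\<close>

lemma hausdorff_measure_ne_0_of_inverse_holder:
  fixes \<phi> :: "real \<Rightarrow> real"
  assumes s: "s > 0" and C: "C > 0" and \<phi>S: "\<And>u. u \<in> {0..<1} \<Longrightarrow> \<phi> u \<in> S"
    and holder: "\<And>u v. u \<in> {0..<1} \<Longrightarrow> v \<in> {0..<1} \<Longrightarrow> \<bar>u - v\<bar> \<le> C * \<bar>\<phi> u - \<phi> v\<bar> powr s"
  shows "hausdorff_measure s S \<noteq> 0"
proof -
  have "ennreal (1 / C) \<le> hausdorff_premeasure s 1 S"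
    unfolding hausdorff_premeasure_def
  proof (rule INF_greatest)
    fix U :: "nat \<Rightarrow> real set"
    assume "U \<in> {U. S \<subseteq> (\<Union>i. U i) \<and> (\<forall>i. bounded (U i) \<and> diameter (U i) \<le> 1)}"
    then have cover: "S \<subseteq> (\<Union>i. U i)" and bdd: "\<And>i. bounded (U i)" by auto
    define B where "B = (\<lambda>i. {u \<in> {0..<1}. \<phi> u \<in> U i})"
    \<comment> \<open>The preimages \<open>B i\<close> need not be measurable; their closed convex
      hulls are, with the same diameter.\<close>
    define J where "J = (\<lambda>i. if B i = {} then {} else {Inf (B i)..Sup (B i)})"
    have bB: "bdd_below (B i)" "bdd_above (B i)" for i
      by (auto simp: B_def intro!: bdd_belowI[of _ 0] bdd_aboveI[of _ 1])
    have BJ: "B i \<subseteq> J i" for i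
      using cInf_lower[OF _ bB(1)] cSup_upper[OF _ bB(2)] by (auto simp: J_def)
    have "{0..<1} \<subseteq> (\<Union>i. J i)"
    proof
      fix u :: real assume u: "u \<in> {0..<1}"
      then obtain i where "\<phi> u \<in> U i" using cover \<phi>S by blast
      then have "u \<in> B i" using u by (simp add: B_def)
      then show "u \<in> (\<Union>i. J i)" using BJ by blast
    qed
    then have "emeasure lborel {0..<1::real} \<le> emeasure lborel (\<Union>i. J i)"
      by (intro emeasure_mono) (auto simp: J_def)
    also have "\<dots> \<le> (\<Sum>i. emeasure lborel (J i))"
      by (intro emeasure_subadditive_countably) (auto simp: J_def)
    also have "\<dots> \<le> (\<Sum>i. ennreal C * diameter_weight s (U i))"
    proof (intro suminf_le summableI)
      fix i
      show "emeasure lborel (J i) \<le> ennreal C * diameter_weight s (U i)"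
      proof (cases "B i = {}")
        case False
        let ?D = "C * diameter (U i) powr s"
        have diff: "u - v \<le> ?D" if "u \<in> B i" "v \<in> B i" for u v
        proof -
          have "u - v \<le> C * \<bar>\<phi> u - \<phi> v\<bar> powr s" using holder[of u v] that by (auto simp: B_def)
          also have "\<bar>\<phi> u - \<phi> v\<bar> powr s \<le> diameter (U i) powr s"
            using diameter_bounded_bound[OF bdd, of "\<phi> u" i "\<phi> v"] that s
            by (intro powr_mono2) (auto simp: B_def dist_real_def)
          finally show ?thesis using C by simp
        qed
        have "Sup (B i) \<le> Inf (B i) + ?D"
        proof (rule cSup_least[OF False])
          fix u assume u: "u \<in> B i"
          have "u - ?D \<le> Inf (B i)"
            using diff[OF u] by (intro cInf_greatest[OF False]) (simp add: algebra_simps)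
          then show "u \<le> Inf (B i) + ?D" by simp
        qed
        moreover have "Inf (B i) \<le> Sup (B i)" using False bB by (intro cInf_le_cSup)
        ultimately have "emeasure lborel (J i) \<le> ennreal ?D"
          using False by (simp add: J_def ennreal_leI)
        also have "\<dots> = ennreal C * diameter_weight s (U i)"
        proof -
          have "U i \<noteq> {}" using False by (auto simp: B_def)
          then show ?thesis using C s by (simp add: diameter_weight_def ennreal_mult)
        qed
        finally show ?thesis .
      qed (simp add: J_def)
    qed
    also have "\<dots> = ennreal C * (\<Sum>i. diameter_weight s (U i))" by simp
    finally have "1 \<le> ennreal C * (\<Sum>i. diameter_weight s (U i))" by simp
    then have "ennreal (1 / C) * 1 \<le> ennreal (1 / C) * (ennreal C * (\<Sum>i. diameter_weight s (U i)))"
      by (rule mult_left_mono) simp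
    also have "\<dots> = (\<Sum>i. diameter_weight s (U i))"
      using C by (simp add: mult.assoc[symmetric] flip: ennreal_mult)
    finally show "ennreal (1 / C) \<le> (\<Sum>i. diameter_weight s (U i))" by simp
  qed
  also have "\<dots> \<le> hausdorff_measure s S"
    unfolding hausdorff_measure_def by (intro SUP_upper) auto
  finally show ?thesis using C by (auto simp: ennreal_eq_0_iff not_le)
qed

text \<open>The exponent 0 takes part in the infimum defining \<open>hausdorff_dim\<close>, but the
  Hoelder criterion covers only positive exponents. At s = 0 any nonempty member of a cover has
  weight 1.\<close>

lemma hausdorff_measure_0_ne_0:
  assumes "S \<noteq> {}" shows "hausdorff_measure 0 S \<noteq> 0"
proof -
  have "1 \<le> hausdorff_premeasure 0 1 S"
    unfolding hausdorff_premeasure_def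
  proof (rule INF_greatest)
    fix U :: "nat \<Rightarrow> 'a set"
    assume "U \<in> {U. S \<subseteq> (\<Union>i. U i) \<and> (\<forall>i. bounded (U i) \<and> diameter (U i) \<le> 1)}"
    then obtain i where "U i \<noteq> {}" using assms by blast
    then have "1 = (\<Sum>i\<in>{i}. diameter_weight 0 (U i))" by (simp add: diameter_weight_def)
    also have "\<dots> \<le> (\<Sum>i. diameter_weight 0 (U i))" by (intro sum_le_suminf summableI) auto
    finally show "1 \<le> (\<Sum>i. diameter_weight 0 (U i))" .
  qed
  also have "\<dots> \<le> hausdorff_measure 0 S"
    unfolding hausdorff_measure_def by (intro SUP_upper) auto
  finally show ?thesis by auto
qed

text \<open>The one-dimensional measure of S may be positive, so the upper bound is obtained from
  the exponents 1 + 1/(n + 1).\<close>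

lemma hausdorff_dim_real_eq_1:
  fixes S :: "real set"
  assumes "S \<noteq> {}" and "\<And>s. 0 < s \<Longrightarrow> s < 1 \<Longrightarrow> hausdorff_measure s S \<noteq> 0"
  shows "hausdorff_dim S = 1"
proof (rule antisym)
  show "hausdorff_dim S \<le> 1"
  proof (rule LIMSEQ_le_const)
    have "(\<lambda>n. 1 + 1 / real (Suc n)) \<longlonglongrightarrow> 1 + 0"
      using LIMSEQ_inverse_real_of_nat by (intro tendsto_add) (simp_all add: inverse_eq_divide)
    then show "(\<lambda>n. ennreal (1 + 1 / real (Suc n))) \<longlonglongrightarrow> 1" by (auto dest: tendsto_ennrealI)
    show "\<exists>N. \<forall>n\<ge>N. hausdorff_dim S \<le> ennreal (1 + 1 / real (Suc n))"
      unfolding hausdorff_dim_def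
      by (intro exI allI impI INF_lower) (auto intro!: hausdorff_measure_real_eq_0)
  qed
  show "1 \<le> hausdorff_dim S"
    unfolding hausdorff_dim_def
  proof (rule INF_greatest)
    fix s assume s: "s \<in> {s. s \<ge> 0 \<and> hausdorff_measure s S = 0}"
    have "\<not> s < 1"
      using s assms(2)[of s] hausdorff_measure_0_ne_0[OF assms(1)] by (cases "s = 0") auto
    then show "1 \<le> ennreal s" by (simp add: not_less)
  qed
qed

section \<open>A Cantor set of AP abnormal numbers\<close>

text \<open>Termwise comparison with half of the string of maximal digits, whose value is at most 1.
  Digits from a common window of length N with 2 N \<le> q satisfy the hypothesis, so tails of
  points of the Cantor set differ by at most 1/2.\<close>

lemma cantor_value_diff_le_half:
  assumes q: "basic_sequence q" and E: "digit_sequence q E" "digit_sequence q F"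
    and close: "\<And>n. n \<ge> 1 \<Longrightarrow> 2 * (E n - F n) \<le> int (q n) - 1"
  shows "cantor_value q E - cantor_value q F \<le> 1 / 2"
proof -
  define G where "G = (\<lambda>n. int (q n) - 1)"
  have "G n \<in> {0..int (q n) - 1}" if "n \<ge> 1" for n
  proof -
    have "q n \<ge> 2" using q that by (simp add: basic_sequence_def)
    then show ?thesis by (simp add: G_def)
  qed
  then have G: "digit_sequence q G" by (simp add: digit_sequence_def)
  define e where "e = (\<lambda>H n. real_of_int (H (Suc n)) / real (\<Prod>k=1..Suc n. q k))"
  have summ: "summable (e H)" if "digit_sequence q H" for H
    unfolding e_def by (rule summable_cantor_series[OF q that])
  have val: "cantor_value q H = suminf (e H)" for H by (simp add: cantor_value_def e_def)
  have "e E n - e F n \<le> e G n / 2" for n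
  proof -
    have "2 * (real_of_int (E (Suc n)) - real_of_int (F (Suc n))) \<le> real_of_int (G (Suc n))"
      using close[of "Suc n"] by (simp add: G_def)
    then have "real_of_int (E (Suc n)) - real_of_int (F (Suc n)) \<le> real_of_int (G (Suc n)) / 2" by simp
    then have "(real_of_int (E (Suc n)) - real_of_int (F (Suc n))) / real (\<Prod>k=1..Suc n. q k)
       \<le> (real_of_int (G (Suc n)) / 2) / real (\<Prod>k=1..Suc n. q k)"
      by (rule divide_right_mono) (rule of_nat_0_le_iff)
    then show ?thesis by (simp add: e_def diff_divide_distrib)
  qed
  then have "(\<Sum>n. e E n - e F n) \<le> (\<Sum>n. e G n / 2)"
    by (intro suminf_le summable_diff summable_divide summ E G)
  also have "(\<Sum>n. e E n - e F n) = cantor_value q E - cantor_value q F"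
    unfolding val by (rule suminf_diff[symmetric]) (intro summ E)+
  also have "(\<Sum>n. e G n / 2) = cantor_value q G / 2"
    unfolding val by (rule suminf_divide[OF summ[OF G]])
  also have "\<dots> \<le> 1 / 2" using cantor_value_bounds(2)[OF q G] by simp
  finally show ?thesis .
qed

lemma cantor_value_diff_eq_tail_diff:
  assumes q: "basic_sequence q" and E: "digit_sequence q E" "digit_sequence q F"
    and eq: "\<And>i. 1 \<le> i \<Longrightarrow> i \<le> n \<Longrightarrow> E i = F i"
  shows "real (\<Prod>k=1..n. q k) * (cantor_value q E - cantor_value q F) = cantor_tail q E n - cantor_tail q F n"
  using eq
proof (induction n)
  case (Suc n)
  have "real (\<Prod>k=1..Suc n. q k) * (cantor_value q E - cantor_value q F)
      = real (q (Suc n)) * (real (\<Prod>k=1..n. q k) * (cantor_value q E - cantor_value q F))"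
    by (simp add: algebra_simps)
  also have "\<dots> = real (q (Suc n)) * cantor_tail q E n - real (q (Suc n)) * cantor_tail q F n"
    using Suc by (simp add: right_diff_distrib)
  also have "\<dots> = cantor_tail q E (Suc n) - cantor_tail q F (Suc n)"
    using Suc.prems[of "Suc n"] by (simp add: cantor_tail_rec[OF q E(1)] cantor_tail_rec[OF q E(2)])
  finally show ?case .
qed (simp add: cantor_tail_0)

text \<open>The numbers \<open>N n\<close> of admissible digits satisfy \<open>q n / N n \<le> 2 L n\<close>, where \<open>L n\<close> tends to infinity but
  \<open>2 L (n + 1)\<close> is bounded by \<open>q n powr \<tau>\<close>: the loss at level \<open>n + 1\<close> is paid for by \<open>q n\<close>,
  however fast or irregularly \<open>q\<close> grows.\<close>

lemma exists_window_sizes: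
  assumes q: "basic_sequence q" "infinite_in_limit q" and \<tau>: "\<tau> > 0"
  shows "\<exists>N C. C > 0 \<and> (\<forall>n\<ge>1. 1 \<le> N n \<and> 2 * N n \<le> q n) \<and>
    (\<lambda>n. real (N n) / real (q n)) \<longlonglongrightarrow> 0 \<and>
    (\<forall>n. real (\<Prod>k=1..Suc n. q k) / real (\<Prod>k=1..Suc n. N k) \<le> C * real (\<Prod>k=1..n. q k) powr \<tau>)"
proof -
  have q2: "q n \<ge> 2" if "n \<ge> 1" for n using q(1) that by (simp add: basic_sequence_def)
  \<comment> \<open>The floor term is the permitted loss, the cap \<open>q n\<close> keeps
    \<open>N n\<close> positive, and the lower bound 2 gives 2 * N n \<le> q n. The meaningless
    value \<open>q 0\<close> enters \<open>L 1\<close>, which is absorbed into C.\<close>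
  define L where "L = (\<lambda>n. max 2 (min (q n) (nat \<lfloor>real (q (n - 1)) powr \<tau> / 2\<rfloor>)))"
  define N where "N = (\<lambda>n. q n div L n)"
  have L2: "L n \<ge> 2" for n by (simp add: L_def)
  have Lq: "L n \<le> q n" if "n \<ge> 1" for n using q2[OF that] by (simp add: L_def)
  have N1: "1 \<le> N n" if "n \<ge> 1" for n
    using Lq[OF that] L2[of n] by (simp add: N_def Suc_le_eq div_greater_zero_iff)
  have N2: "2 * N n \<le> q n" for n
  proof -
    have "2 * N n \<le> L n * N n" using L2 by (intro mult_right_mono) auto
    also have "\<dots> \<le> q n" by (simp add: N_def)
    finally show ?thesis .
  qed
  have ratio: "real (q n) / real (N n) \<le> 2 * real (L n)" if "n \<ge> 1" for n
  proof -
    have "q n < L n * Suc (N n)"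
      unfolding N_def using L2[of n] by (metis dividend_less_times_div mult_Suc_right less_le_trans pos2 add.commute)
    also have "\<dots> \<le> L n * (2 * N n)" using N1[OF that] by (intro mult_left_mono) auto
    finally have "real (q n) \<le> real (L n * (2 * N n))" by linarith
    then show ?thesis using N1[OF that] by (simp add: divide_le_eq)
  qed
  have qtop: "filterlim (\<lambda>n. real (q n)) at_top sequentially"
    using q(2) unfolding infinite_in_limit_def by (rule filterlim_compose[OF filterlim_real_sequentially])
  have powtop: "filterlim (\<lambda>n. real (q n) powr \<tau>) at_top sequentially"
    unfolding filterlim_at_top
  proof
    fix Z :: real
    have "\<forall>\<^sub>F n in sequentially. max Z 1 powr (1 / \<tau>) \<le> real (q n)"
      using qtop by (simp add: filterlim_at_top)
    then show "\<forall>\<^sub>F n in sequentially. Z \<le> real (q n) powr \<tau>"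
    proof eventually_elim
      case (elim n)
      have "Z \<le> (max Z 1 powr (1 / \<tau>)) powr \<tau>" using \<tau> by (simp add: powr_powr)
      also have "\<dots> \<le> real (q n) powr \<tau>" using elim \<tau> by (intro powr_mono2) auto
      finally show ?case .
    qed
  qed
  have Llim: "filterlim L at_top sequentially"
  proof -
    have "filterlim (\<lambda>n. nat \<lfloor>real (q n) powr \<tau> / 2\<rfloor>) at_top sequentially"
    proof (intro filterlim_compose[OF filterlim_nat_sequentially] filterlim_compose[OF filterlim_floor_sequentially])
      show "filterlim (\<lambda>n. real (q n) powr \<tau> / 2) at_top sequentially"
        using filterlim_tendsto_pos_mult_at_top[OF tendsto_const[of "1/2::real"] _ powtop] by simp
    qed
    then have 1: "filterlim (\<lambda>n. nat \<lfloor>real (q (n - 1)) powr \<tau> / 2\<rfloor>) at_top sequentially"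
      by (subst filterlim_sequentially_Suc[symmetric]) simp
    have 2: "filterlim q at_top sequentially" using q(2) by (simp add: infinite_in_limit_def)
    show ?thesis
      unfolding filterlim_at_top
    proof
      fix Z :: nat
      have "\<forall>\<^sub>F n in sequentially. Z \<le> nat \<lfloor>real (q (n - 1)) powr \<tau> / 2\<rfloor>"
        "\<forall>\<^sub>F n in sequentially. Z \<le> q n"
        using 1 2 by (auto simp: filterlim_at_top)
      then show "\<forall>\<^sub>F n in sequentially. Z \<le> L n" by eventually_elim (simp add: L_def)
    qed
  qed
  have lim: "(\<lambda>n. real (N n) / real (q n)) \<longlonglongrightarrow> 0"
  proof (rule tendsto_sandwich[of "\<lambda>_. 0" _ _ "\<lambda>n. 1 / real (L n)"])
    show "\<forall>\<^sub>F n in sequentially. real (N n) / real (q n) \<le> 1 / real (L n)"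
    proof (intro eventually_mono[OF eventually_ge_at_top[of 1]])
      fix n :: nat assume n: "1 \<le> n"
      have "L n * N n \<le> q n" by (simp add: N_def)
      then have "real (L n) * real (N n) \<le> real (q n)" by (metis of_nat_le_iff of_nat_mult)
      then show "real (N n) / real (q n) \<le> 1 / real (L n)"
        using q2[OF n] L2[of n] by (simp add: divide_le_eq le_divide_eq mult.commute)
    qed
    show "(\<lambda>n. 1 / real (L n)) \<longlonglongrightarrow> 0"
      by (intro tendsto_divide_0[OF tendsto_const] filterlim_at_top_imp_at_infinity
          filterlim_compose[OF filterlim_real_sequentially Llim])
  qed auto
  \<comment> \<open>The bound L \<ge> 2 forces factors of at least 4 in K. Only finitely many q_k
    powr \<tau> are below 4, and replacing each by 4 costs at most a factor 4, hence 4 ^ I in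
    C.\<close>
  obtain I where I: "\<And>n. n \<ge> I \<Longrightarrow> real (q n) powr \<tau> \<ge> 4"
    using powtop unfolding filterlim_at_top eventually_sequentially by blast
  define K where "K = (\<lambda>n. \<Prod>k=1..n. max 4 (real (q k) powr \<tau>))"
  have K: "K n \<le> 4 ^ min n I * real (\<Prod>k=1..n. q k) powr \<tau>" for n
  proof (induction n)
    case (Suc n)
    let ?x = "real (q (Suc n)) powr \<tau>" and ?P = "real (\<Prod>k=1..n. q k)"
    have x1: "?x \<ge> 1" using q2[of "Suc n"] \<tau> by (intro ge_one_powr_ge_zero) auto
    have "K (Suc n) = K n * max 4 ?x" by (simp add: K_def)
    also have "\<dots> \<le> 4 ^ min n I * ?P powr \<tau> * max 4 ?x"
      by (intro mult_right_mono Suc) auto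
    also have "\<dots> \<le> 4 ^ min n I * ?P powr \<tau> * ((if Suc n \<le> I then 4 else 1) * ?x)"
      using x1 I[of "Suc n"] by (intro mult_left_mono) auto
    also have "\<dots> = 4 ^ min (Suc n) I * (?P powr \<tau> * ?x)"
      by (auto simp: min_def not_less_eq_eq)
    also have "?P powr \<tau> * ?x = real (\<Prod>k=1..Suc n. q k) powr \<tau>"
      by (simp add: powr_mult prod_nonneg)
    finally show ?case .
  qed (simp add: K_def)
  have LK: "(\<Prod>k=1..Suc n. 2 * real (L k)) \<le> 2 * real (L 1) * K n" for n
  proof (induction n)
    case (Suc n)
    have "2 * real (L (Suc (Suc n))) \<le> max 4 (real (q (Suc n)) powr \<tau>)"
    proof -
      have "real (nat \<lfloor>real (q (Suc n)) powr \<tau> / 2\<rfloor>) \<le> real (q (Suc n)) powr \<tau> / 2"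
        by (rule of_nat_floor) simp
      then show ?thesis by (auto simp: L_def)
    qed
    then have "(\<Prod>k=1..Suc n. 2 * real (L k)) * (2 * real (L (Suc (Suc n))))
        \<le> (2 * real (L 1) * K n) * max 4 (real (q (Suc n)) powr \<tau>)"
      by (intro mult_mono Suc) (auto simp: K_def intro!: mult_nonneg_nonneg prod_nonneg)
    then show ?case by (simp add: K_def mult.assoc)
  qed (simp add: K_def)
  define C where "C = 2 * real (L 1) * 4 ^ I"
  have C: "C > 0" using L2[of 1] by (simp add: C_def)
  have "real (\<Prod>k=1..Suc n. q k) / real (\<Prod>k=1..Suc n. N k) \<le> C * real (\<Prod>k=1..n. q k) powr \<tau>" for n
  proof -
    have "real (\<Prod>k=1..Suc n. q k) / real (\<Prod>k=1..Suc n. N k) = (\<Prod>k=1..Suc n. real (q k) / real (N k))"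
      by (simp only: of_nat_prod prod_dividef)
    also have "\<dots> \<le> (\<Prod>k=1..Suc n. 2 * real (L k))"
      by (intro prod_mono) (auto intro!: ratio)
    also have "\<dots> \<le> 2 * real (L 1) * K n" by (rule LK)
    also have "\<dots> \<le> 2 * real (L 1) * (4 ^ min n I * real (\<Prod>k=1..n. q k) powr \<tau>)"
      by (intro mult_left_mono K) auto
    also have "\<dots> \<le> 2 * real (L 1) * (4 ^ I * real (\<Prod>k=1..n. q k) powr \<tau>)"
      by (intro mult_left_mono mult_right_mono power_increasing) auto
    finally show ?thesis by (simp only: C_def mult.assoc)
  qed
  with C N1 N2 lim show ?thesis by (intro exI[of _ N] exI[of _ C]) blast
qed

text \<open>A weighted geometric mean of two upper bounds is an upper bound. It combines the
  estimates of a distance at the last level where two points agree and at the level where they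
  separate.\<close>

lemma le_interpolate_powr:
  fixes w a b s :: real
  assumes "0 < w" "w \<le> a" "w \<le> b" "0 \<le> s" "s \<le> 1"
  shows "w \<le> a powr (1 - s) * b powr s"
proof -
  have "w = w powr (1 - s) * w powr s" using assms by (simp flip: powr_add)
  also have "\<dots> \<le> a powr (1 - s) * b powr s"
    using assms by (intro mult_mono powr_mono2) auto
  finally show ?thesis .
qed

text \<open>The map sends \<open>u\<close> to the number whose \<open>n\<close>-th digit is the \<open>n\<close>-th digit of \<open>u\<close> in base \<open>(N n)\<close>, moved into
  a window of \<open>N n\<close> consecutive digits at relative position \<open>y (n - 1)\<close>. As \<open>N n / q n\<close> tends to 0, this pins
  down the orbit asymptotically; as \<open>2 * N n \<le> q n\<close>, neighbouring cylinders stay apart.\<close>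

lemma exists_inverse_holder_map:
  assumes q: "basic_sequence q" "infinite_in_limit q" and y: "\<And>n. 0 \<le> y n" "\<And>n. y n < (1::real)"
    and s: "0 < s" "s < 1"
  shows "\<exists>\<phi> C. C > 0 \<and> (\<forall>u\<in>{0..<1}. (\<lambda>n. cantor_T q n (\<phi> u) - y n) \<longlonglongrightarrow> 0) \<and>
    (\<forall>u\<in>{0..<1}. \<forall>v\<in>{0..<1}. \<bar>u - v\<bar> \<le> C * \<bar>\<phi> u - \<phi> v\<bar> powr s)"
proof -
  obtain N :: "nat \<Rightarrow> nat" and C where C: "C > 0" and N: "\<forall>n\<ge>1. 1 \<le> N n \<and> 2 * N n \<le> q n"
    and Nlim: "(\<lambda>n. real (N n) / real (q n)) \<longlonglongrightarrow> 0"
    and size: "\<forall>n. real (\<Prod>k=1..Suc n. q k) / real (\<Prod>k=1..Suc n. N k) \<le> C * real (\<Prod>k=1..n. q k) powr (1 - s)"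
    using exists_window_sizes[OF q, of "1 - s"] s by auto
  define P where "P = (\<lambda>n. real (\<Prod>k=1..n. q k))"
  define M where "M = (\<lambda>n. real (\<Prod>k=1..n. N k))"
  have N1: "N (Suc n) \<ge> 1" and N2: "2 * N (Suc n) \<le> q (Suc n)" for n using N by simp_all
  have PS: "P (Suc n) = real (q (Suc n)) * P n" and P0: "P 0 = 1" for n by (simp_all add: P_def)
  have MS: "M (Suc n) = real (N (Suc n)) * M n" and M0: "M 0 = 1" for n by (simp_all add: M_def)
  have Ppos: "P n > 0" for n
    unfolding P_def using basic_sequence_prod_pos[OF q(1), of n] by linarith
  have Mpos: "M n > 0" for n
  proof (induction n)
    case (Suc n)
    then show ?case using N1[of n] by (simp add: MS)
  qed (simp add: M0)
  have size': "P (Suc n) / M (Suc n) \<le> C * P n powr (1 - s)" for n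
    using size by (simp add: P_def M_def del: of_nat_prod prod.cl_ivl_Suc)
  have ratio_mono: "P n / M n \<le> P (Suc n) / M (Suc n)" for n
  proof -
    have "1 \<le> real (q (Suc n)) / real (N (Suc n))" using N1[of n] N2[of n] by (simp add: le_divide_eq)
    then have "1 * (P n / M n) \<le> real (q (Suc n)) / real (N (Suc n)) * (P n / M n)"
      using Ppos[of n] Mpos[of n] by (intro mult_right_mono) auto
    then show ?thesis by (simp add: PS MS)
  qed
  define d where "d = (\<lambda>u n. \<lfloor>M n * u\<rfloor> - int (N n) * \<lfloor>M (n - 1) * u\<rfloor>)"
  \<comment> \<open>Scaling y by q - N instead of q leaves room for the whole window. All digits are
    then at most q - 2, so the tails stay below 1.\<close>
  define a where "a = (\<lambda>n. \<lfloor>y (n - 1) * (real (q n) - real (N n))\<rfloor>)"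
  define E where "E = (\<lambda>u n. a n + d u n)"
  have d: "0 \<le> d u (Suc n)" "d u (Suc n) < int (N (Suc n))" for u n
    using floor_digit_bounds[of "N (Suc n)" "M n * u"] N1[of n] by (simp_all add: d_def MS mult.assoc)
  have a: "0 \<le> a (Suc n)" "a (Suc n) < int (q (Suc n)) - int (N (Suc n))" for n
  proof -
    have pos: "real (q (Suc n)) - real (N (Suc n)) > 0" using N1[of n] N2[of n] by linarith
    then show "0 \<le> a (Suc n)" using y(1)[of n] by (simp add: a_def)
    have "y n * (real (q (Suc n)) - real (N (Suc n))) < 1 * (real (q (Suc n)) - real (N (Suc n)))"
      using pos y(2) by (intro mult_strict_right_mono) auto
    then show "a (Suc n) < int (q (Suc n)) - int (N (Suc n))" by (simp add: a_def floor_less_iff)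
  qed
  have E: "0 \<le> E u (Suc n)" "E u (Suc n) < int (q (Suc n)) - 1" for u n
    using a[of n] d[of u n] by (auto simp: E_def)
  have dig: "digit_sequence q (E u)" for u
    unfolding digit_sequence_def
  proof (intro allI impI)
    fix n :: nat assume "1 \<le> n"
    then obtain k where "n = Suc k" by (cases n) auto
    then show "E u n \<in> {0..int (q n) - 1}" using E[of u k] by simp
  qed
  define \<phi> where "\<phi> = (\<lambda>u. cantor_value q (E u))"
  \<comment> \<open>The digit deviates from y n * q by at most N through its place in the window and
    by at most 1 through the floor; the second 1 / q accounts for the remaining tail.\<close>
  have orbit: "(\<lambda>n. cantor_T q n (\<phi> u) - y n) \<longlonglongrightarrow> 0" for u
  proof (rule Lim_null_comparison)
    show "\<forall>\<^sub>F n in sequentially. norm (cantor_T q n (\<phi> u) - y n)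
        \<le> real (N (Suc n)) / real (q (Suc n)) + 2 * (1 / real (q (Suc n)))"
    proof (intro always_eventually allI)
      fix n
      let ?q = "real (q (Suc n))" and ?N = "real (N (Suc n))" and ?e = "real_of_int (E u (Suc n))"
      have qpos: "?q > 0" using basic_sequence_pos[OF q(1)] by simp
      have "cantor_tail q (E u) n < 1"
        using E(2)[of u n] by (intro cantor_tail_less_1[OF q(1) dig, of _ "Suc n"]) auto
      then have "cantor_T q n (\<phi> u) = cantor_tail q (E u) n"
        using cantor_tail_bounds(1)[OF q(1) dig, of u n]
        unfolding cantor_T_def \<phi>_def frac_prod_cantor_value[OF q(1) dig] by (simp add: frac_eq)
      then have 1: "\<bar>cantor_T q n (\<phi> u) - ?e / ?q\<bar> \<le> 1 / ?q"
        using cantor_tail_near_digit[OF q(1) dig, of u n] by simp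
      have an: "real_of_int (a (Suc n)) \<le> y n * (?q - ?N)" "y n * (?q - ?N) < real_of_int (a (Suc n)) + 1"
        by (auto simp: a_def)
      have yN: "0 \<le> y n * ?N" "y n * ?N \<le> ?N" using y[of n] by (auto simp: mult_left_le_one_le)
      have dn: "0 \<le> real_of_int (d u (Suc n))" "real_of_int (d u (Suc n)) \<le> ?N"
        using d[of u n] by linarith+
      have "\<bar>?e - y n * ?q\<bar> \<le> ?N + 1"
        using an yN dn by (simp add: E_def right_diff_distrib abs_le_iff)
      then have "\<bar>?e - y n * ?q\<bar> / ?q \<le> (?N + 1) / ?q" using qpos by (intro divide_right_mono) auto
      also have "\<bar>?e - y n * ?q\<bar> / ?q = \<bar>?e / ?q - y n\<bar>"
      proof -
        have "?e / ?q - y n = (?e - y n * ?q) / ?q" using qpos by (simp add: diff_divide_distrib)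
        then show ?thesis using qpos by (simp add: abs_divide)
      qed
      finally have "\<bar>?e / ?q - y n\<bar> \<le> ?N / ?q + 1 / ?q" by (simp add: add_divide_distrib)
      with 1 show "norm (cantor_T q n (\<phi> u) - y n) \<le> ?N / ?q + 2 * (1 / ?q)" by simp
    qed
    have "(\<lambda>n. real (N (Suc n)) / real (q (Suc n))) \<longlonglongrightarrow> 0" using Nlim by (rule LIMSEQ_Suc)
    moreover have "(\<lambda>n. 1 / real (q (Suc n))) \<longlonglongrightarrow> 0"
      by (rule infinite_in_limit_inverse[OF q(2) filterlim_Suc])
    ultimately have "(\<lambda>n. real (N (Suc n)) / real (q (Suc n)) + 2 * (1 / real (q (Suc n)))) \<longlonglongrightarrow> 0 + 2 * 0"
      by (intro tendsto_add tendsto_mult tendsto_const)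
    then show "(\<lambda>n. real (N (Suc n)) / real (q (Suc n)) + 2 * (1 / real (q (Suc n)))) \<longlonglongrightarrow> 0" by simp
  qed
  \<comment> \<open>\<open>N n\<close> may be 1 at infinitely many levels, so the growth of M is
    extracted from P n / M n \<le> C * P n powr (1 - s). It ensures that distinct parameters are
    separated at some level.\<close>
  have Mlim: "(\<lambda>n. 1 / M n) \<longlonglongrightarrow> 0"
  proof (rule tendsto_sandwich[of "\<lambda>_. 0" _ _ "\<lambda>n. C * (1 / P n) powr s"])
    show "\<forall>\<^sub>F n in sequentially. 1 / M n \<le> C * (1 / P n) powr s"
    proof (intro always_eventually allI)
      fix n
      have "P n / M n \<le> C * P n powr (1 - s)" using ratio_mono size' by (rule order_trans)
      then have "(P n / M n) / P n \<le> C * P n powr (1 - s) / P n"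
        using Ppos[of n] by (intro divide_right_mono) auto
      also have "\<dots> = C * (1 / P n) powr s"
        using Ppos[of n] by (simp add: powr_diff powr_divide)
      finally show "1 / M n \<le> C * (1 / P n) powr s" using Ppos[of n] by simp
    qed
    have "(\<lambda>n. (1 / P n) powr s) \<longlonglongrightarrow> 0 powr s"
      using inverse_prod_tendsto_0[OF q(1)] s Ppos unfolding P_def[symmetric]
      by (intro tendsto_powr' tendsto_const) (auto intro!: always_eventually less_imp_le simp: P_def)
    then have "(\<lambda>n. C * (1 / P n) powr s) \<longlonglongrightarrow> C * 0 powr s" by (intro tendsto_mult tendsto_const)
    then show "(\<lambda>n. C * (1 / P n) powr s) \<longlonglongrightarrow> 0" using s by simp
  qed (use Mpos in \<open>auto intro!: always_eventually less_imp_le\<close>)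
  have holder: "v - u \<le> 4 * C * \<bar>\<phi> v - \<phi> u\<bar> powr s" if uv: "0 \<le> u" "u < v" "v < 1" for u v
  proof -
    have floor_mono': "\<lfloor>M n * u\<rfloor> \<le> \<lfloor>M n * v\<rfloor>" for n
      using uv Mpos[of n] by (intro floor_mono mult_left_mono) auto
    have "\<exists>n. \<lfloor>M n * u\<rfloor> \<noteq> \<lfloor>M n * v\<rfloor>"
    proof -
      have "\<forall>\<^sub>F n in sequentially. 1 / M n < v - u" using Mlim uv by (intro order_tendstoD) auto
      then obtain n where "1 / M n < v - u" by (auto simp: eventually_sequentially)
      then have "1 < (v - u) * M n" using Mpos[of n] by (simp only: pos_divide_less_eq)
      then have "1 < M n * v - M n * u" by (simp add: algebra_simps)
      then have "\<lfloor>M n * u\<rfloor> < \<lfloor>M n * v\<rfloor>" by linarith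
      then show ?thesis by (metis less_irrefl)
    qed
    then obtain n' where n': "\<lfloor>M n' * u\<rfloor> \<noteq> \<lfloor>M n' * v\<rfloor>" "\<And>i. i < n' \<Longrightarrow> \<lfloor>M i * u\<rfloor> = \<lfloor>M i * v\<rfloor>"
      using exists_least_iff[of "\<lambda>n. \<lfloor>M n * u\<rfloor> \<noteq> \<lfloor>M n * v\<rfloor>"] by blast
    have "\<lfloor>M 0 * u\<rfloor> = \<lfloor>M 0 * v\<rfloor>" using uv by (simp add: M0 floor_eq_iff[where a = 0, THEN iffD2] floor_unique)
    then obtain n where n: "n' = Suc n" using n'(1) by (cases n') auto
    \<comment> \<open>Level n + 1 is the first at which u and v lie in different cells of mesh 1 /
      M. The window offset a does not depend on the parameter, so k is also the difference of the
      digits of the images.\<close>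
    define k where "k = \<lfloor>M (Suc n) * v\<rfloor> - \<lfloor>M (Suc n) * u\<rfloor>"
    have k1: "k \<ge> 1" using n'(1) floor_mono'[of "Suc n"] by (simp add: k_def n)
    have same: "\<lfloor>M i * u\<rfloor> = \<lfloor>M i * v\<rfloor>" if "i \<le> n" for i using n'(2)[of i] that n by simp
    have Eeq: "E v i = E u i" if "i \<le> n" for i
      using same[of i] same[of "i - 1"] that by (simp add: E_def d_def)
    have Ek: "E v (Suc n) - E u (Suc n) = k"
      using same[of n] by (simp add: E_def d_def k_def)
    have half: "cantor_tail q (E u) (Suc n) - cantor_tail q (E v) (Suc n) \<le> 1 / 2"
      unfolding cantor_tail_def
    proof (intro cantor_value_diff_le_half basic_sequence_shift digit_sequence_shift q dig)
      fix i :: nat assume "1 \<le> i"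
      have "2 * (d u (Suc (n + i)) - d v (Suc (n + i))) \<le> int (q (Suc (n + i))) - 1"
        using d[of u "n + i"] d[of v "n + i"] of_nat_mono[OF N2[of "n + i"], where 'a = int] by simp
      then show "2 * (E u (Suc n + i) - E v (Suc n + i)) \<le> int (q (Suc n + i)) - 1"
        by (simp add: E_def)
    qed
    define r where "r = \<phi> v - \<phi> u"
    have "P (Suc n) * r = real (q (Suc n)) * (P n * (\<phi> v - \<phi> u))"
      by (simp add: r_def PS)
    also have "\<dots> = real (q (Suc n)) * (cantor_tail q (E v) n - cantor_tail q (E u) n)"
      unfolding P_def \<phi>_def
      by (subst cantor_value_diff_eq_tail_diff[OF q(1) dig dig]) (auto intro: Eeq)
    also have "\<dots> = real_of_int k + (cantor_tail q (E v) (Suc n) - cantor_tail q (E u) (Suc n))"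
      using cantor_tail_rec[OF q(1) dig, of n v] cantor_tail_rec[OF q(1) dig, of n u]
      by (simp add: right_diff_distrib flip: Ek)
    finally have "P (Suc n) * r \<ge> real_of_int k - 1 / 2" using half by linarith
    \<comment> \<open>As k \<ge> 1, both k + 1 \<le> 2 k and k - 1/2 \<ge> k / 2 hold; together they
      produce the factor 4 in the distance estimate.\<close>
    then have "2 * real_of_int k \<le> 4 * (P (Suc n) * r)" using k1 by linarith
    moreover have "0 < 2 * real_of_int k" using k1 by simp
    ultimately have r: "2 * real_of_int k \<le> 4 * (P (Suc n) * r)" and "0 < P (Suc n) * r" by linarith+
    then have rpos: "r > 0" using Ppos[of "Suc n"] by (simp add: zero_less_mult_iff)
    have w1: "v - u \<le> 1 / M n"
    proof -
      have "M n * v - M n * u \<le> 1" using same[of n] by linarith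
      then show ?thesis using Mpos[of n] by (simp add: le_divide_eq algebra_simps)
    qed
    have w2: "v - u \<le> 4 * r * (P (Suc n) / M (Suc n))"
    proof -
      have "M (Suc n) * v - M (Suc n) * u \<le> real_of_int k + 1" unfolding k_def by linarith
      also have "\<dots> \<le> 2 * real_of_int k" using k1 by linarith
      also note r
      finally show ?thesis using Mpos[of "Suc n"] by (simp add: le_divide_eq algebra_simps)
    qed
    \<comment> \<open>Interpolation between ?\<rho> / P n and 4 r ?\<rho> leaves ?\<rho> with total
      exponent 1 over P n powr (1 - s), exactly the quotient bounded by C. This is why the window
      sizes are measured against P n and not P (Suc n).\<close>
    let ?\<rho> = "P (Suc n) / M (Suc n)"
    have \<rho>pos: "?\<rho> > 0" using Ppos Mpos by simp
    have "v - u \<le> (1 / M n) powr (1 - s) * (4 * r * ?\<rho>) powr s"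
      using uv s by (intro le_interpolate_powr w1 w2) auto
    also have "\<dots> \<le> (?\<rho> / P n) powr (1 - s) * (4 * r * ?\<rho>) powr s"
    proof -
      have "1 / M n = (P n / M n) / P n" using Ppos[of n] by simp
      also have "\<dots> \<le> ?\<rho> / P n" using ratio_mono Ppos[of n] by (intro divide_right_mono) auto
      finally show ?thesis using Mpos[of n] s by (intro mult_right_mono powr_mono2) auto
    qed
    also have "\<dots> = 4 powr s * r powr s * (?\<rho> / P n powr (1 - s))"
    proof -
      have \<rho>: "?\<rho> powr (1 - s) * ?\<rho> powr s = ?\<rho>"
        using Ppos[of "Suc n"] Mpos[of "Suc n"] by (simp flip: powr_add)
      have "(?\<rho> / P n) powr (1 - s) * (4 * r * ?\<rho>) powr s
          = (?\<rho> powr (1 - s) / P n powr (1 - s)) * (4 powr s * r powr s * ?\<rho> powr s)"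
        by (simp only: powr_divide[of ?\<rho> "P n"] powr_mult)
      also have "\<dots> = 4 powr s * r powr s * ((?\<rho> powr (1 - s) * ?\<rho> powr s) / P n powr (1 - s))"
        by (simp only: times_divide_eq_left times_divide_eq_right mult.assoc mult.commute mult.left_commute)
      finally show ?thesis unfolding \<rho> .
    qed
    also have "\<dots> \<le> 4 * r powr s * C"
    proof (intro mult_mono)
      show "4 powr s \<le> (4::real)" using s powr_mono[of s 1 4] by simp
      show "?\<rho> / P n powr (1 - s) \<le> C"
        using size'[of n] Ppos[of n] by (subst pos_divide_le_eq) auto
      show "0 \<le> ?\<rho> / P n powr (1 - s)"
        using less_imp_le[OF \<rho>pos] by (rule divide_nonneg_nonneg) simp
    qed auto
    finally show ?thesis using rpos by (simp add: r_def mult.commute mult.left_commute)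
  qed
  have "\<bar>u - v\<bar> \<le> 4 * C * \<bar>\<phi> u - \<phi> v\<bar> powr s" if "u \<in> {0..<1}" "v \<in> {0..<1}" for u v
  proof (cases u v rule: linorder_cases)
    case less
    then show ?thesis using holder[of u v] that by (simp add: abs_minus_commute)
  next
    case greater
    then show ?thesis using holder[of v u] that by simp
  qed simp
  with C orbit show ?thesis by (intro exI[of _ \<phi>] exI[of _ "4 * C"]) auto
qed

theorem mainTheorem2:
  fixes q :: "nat \<Rightarrow> nat"
  assumes "basic_sequence q" and "infinite_in_limit q"
  shows "(\<forall>x. AP_distribution_normal_I q x \<longleftrightarrow> AP_distribution_normal_II q x) \<and>
         meagre {x. distribution_normal q x \<and> AP_distribution_abnormal q x} \<and>
         {x. distribution_normal q x \<and> AP_distribution_abnormal q x} \<in> null_sets lebesgue \<and>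
         hausdorff_dim {x. distribution_normal q x \<and> AP_distribution_abnormal q x} = 1"
proof (intro conjI allI)
  let ?S = "{x. distribution_normal q x \<and> AP_distribution_abnormal q x}"
  show "AP_distribution_normal_I q x \<longleftrightarrow> AP_distribution_normal_II q x" for x
    by (rule AP_distribution_normal_I_iff_II[OF assms])
  show "meagre ?S" by (rule meagre_distribution_normal[OF assms(1)]) auto
  have "?S \<subseteq> {x. \<not> ud_mod1 (\<lambda>n. cantor_T q (2 * n) x)}"
  proof
    fix x assume "x \<in> ?S"
    then have "\<not> ud_mod1 (\<lambda>n. cantor_T q (2 * n + 0) x)"
      unfolding AP_distribution_abnormal_def by (elim CollectE conjE allE[of _ 2] allE[of _ 0] impE) auto
    then show "x \<in> {x. \<not> ud_mod1 (\<lambda>n. cantor_T q (2 * n) x)}" by simp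
  qed
  with negligible_not_ud_even_progression[OF assms(1)] have "negligible ?S" by (rule negligible_subset)
  then show "?S \<in> null_sets lebesgue" by (simp only: negligible_iff_null_sets)
  obtain y where y: "range y \<subseteq> {0..<1}" "ud_mod1 y" "\<forall>m\<ge>2. \<forall>r<m. \<not> ud_mod1 (\<lambda>n. y (m * n + r))"
    using exists_ud_AP_abnormal by blast
  have y01: "0 \<le> y n" "y n < 1" for n using subsetD[OF y(1) rangeI] by auto
  have mem: "x \<in> ?S" if lim: "(\<lambda>n. cantor_T q n x - y n) \<longlonglongrightarrow> 0" for x
  proof -
    have T0: "cantor_T q n x \<ge> 0" for n by (simp add: cantor_T_def)
    have "ud_mod1 (\<lambda>n. cantor_T q n x)"
      using ud_mod1_cong_tendsto[OF T0 y01(1) lim] y(2) by simp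
    moreover have "\<not> ud_mod1 (\<lambda>n. cantor_T q (m * n + r) x)" if "m > 1" "r < m" for m r
    proof -
      have "filterlim (\<lambda>n. m * n + r) at_top sequentially"
        using that by (intro filterlim_arith_progression) simp
      then have "(\<lambda>n. cantor_T q (m * n + r) x - y (m * n + r)) \<longlonglongrightarrow> 0"
        by (rule filterlim_compose[OF lim])
      then have "ud_mod1 (\<lambda>n. cantor_T q (m * n + r) x) \<longleftrightarrow> ud_mod1 (\<lambda>n. y (m * n + r))"
        by (intro ud_mod1_cong_tendsto T0 y01)
      then show ?thesis using y(3) that by simp
    qed
    ultimately show ?thesis by (simp add: distribution_normal_def AP_distribution_abnormal_def)
  qed
  have ne0: "hausdorff_measure s ?S \<noteq> 0 \<and> ?S \<noteq> {}" if s: "0 < s" "s < 1" for s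
  proof -
    obtain \<phi> C where C: "C > 0"
      and orbit: "\<forall>u\<in>{0..<1}. (\<lambda>n. cantor_T q n (\<phi> u) - y n) \<longlonglongrightarrow> 0"
      and holder: "\<forall>u\<in>{0..<1}. \<forall>v\<in>{0..<1}. \<bar>u - v\<bar> \<le> C * \<bar>\<phi> u - \<phi> v\<bar> powr s"
      using exists_inverse_holder_map[where y = y, OF assms y01 s] by blast
    have \<phi>: "\<phi> u \<in> ?S" if "u \<in> {0..<1}" for u using orbit that by (intro mem) blast
    have "hausdorff_measure s ?S \<noteq> 0"
      using holder by (intro hausdorff_measure_ne_0_of_inverse_holder[OF s(1) C, of \<phi>] \<phi>) auto
    moreover have "\<phi> 0 \<in> ?S" by (rule \<phi>) simp
    ultimately show ?thesis by blast
  qed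
  show "hausdorff_dim ?S = 1"
    \<comment> \<open>The instance s = 1/2 supplies nonemptiness.\<close>
    using ne0[of "1/2"] ne0 by (intro hausdorff_dim_real_eq_1) auto
qed

end
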